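(* There exists an absolute constant $c>0$ such that the following holds. Let $\varepsilon\in(0,1)$, let $N \geq 1+\exp(e^e)$ be an integer and let $A,B,C$ be nonempty subsets of $\mathbb{Z}/N\mathbb{Z}$ of respective densities $\alpha=|A|/N$, $\beta=|B|/N$, $\gamma=|C|/N$. If $$\alpha\,\Big(\log\tfrac{2}{\alpha\beta\gamma}\Big)^{-14} \geq (c\,\varepsilon\log N)^{-2},$$ then $A+B+C$ contains an arithmetic progression of length at least $$\exp\Big(c\,\alpha^{1/4}(\varepsilon\log N)^{1/2}\big(\log\tfrac{2}{\alpha\beta\gamma}\big)^{-7/2}\Big)$$ such that each element of the progression has at least $N^{2-\varepsilon}$ representations as a sum $x+y+z$ with $(x,y,z)\in A\times B\times C$.
   Context: All logarithms are natural logarithms. *)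

theory Defs
  imports Complex_Main
begin

text \<open>Z/NZ is modelled by the residues {0..<N} (nat), with addition mod N.\<close>

definition reps :: "nat \<Rightarrow> nat set \<Rightarrow> nat set \<Rightarrow> nat set \<Rightarrow> nat \<Rightarrow> nat" where
  "reps N A B C t = card {(x, y, z). x \<in> A \<and> y \<in> B \<and> z \<in> C \<and> (x + y + z) mod N = t}"

definition sumset3 :: "nat \<Rightarrow> nat set \<Rightarrow> nat set \<Rightarrow> nat set \<Rightarrow> nat set" where
  "sumset3 N A B C = {(x + y + z) mod N | x y z. x \<in> A \<and> y \<in> B \<and> z \<in> C}"

text \<open>An arithmetic progression of length L in Z/NZ: L pairwise distinct residues a, a+d, ..., a+(L-1)d.\<close>
definition ap_mod :: "nat \<Rightarrow> nat \<Rightarrow> nat \<Rightarrow> nat \<Rightarrow> nat set" where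
  "ap_mod N a d L = {(a + i * d) mod N | i. i < L}"

end

theory Submission
  imports Defs "HOL-Analysis.Kronecker_Approximation_Theorem" "HOL-Analysis.Harmonic_Numbers"
    "HOL-Library.Real_Mod"
begin

text \<open>
  Write \<open>f\<close> for the convolution of the indicator of \<open>A\<close> with the uniform measure on \<open>B\<close>, and let
  \<open>f\<close> be of size at least \<open>\<kappa>\<close> in \<open>L\<^sup>2\<^sup>m\<close>.  Sampling about \<open>m / \<kappa>\<close> (up to logarithms) points of \<open>B\<close>
  gives, by Croot and Sisask, a dense set \<open>T\<close> of almost-periods of \<open>f\<close> in \<open>L\<^sup>2\<^sup>m\<close>.  Averaging \<open>f\<close>
  repeatedly over \<open>T\<close> changes it little and kills all frequencies outside the large spectrum of
  \<open>T\<close>; by Chang's theorem that spectrum is spanned by few characters, and Dirichlet's theorem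
  provides a long progression on which all of them are nearly \<open>1\<close>.  As its length is at most
  \<open>exp (O(m))\<close>, the \<open>L\<^sup>2\<^sup>m\<close> control survives taking a maximum over the progression, as in the
  work of Croot, Laba and Sisask.

  The third set improves \<open>\<kappa>\<close> from \<open>\<alpha>\<close> to \<open>sqrt \<alpha>\<close>: either the popular sums of \<open>A + B\<close> have density
  at least \<open>sqrt \<alpha>\<close>, and one adds \<open>C\<close> to them, or \<open>A + B\<close> is so concentrated that \<open>f\<close> already has
  \<open>L\<^sup>2\<^sup>m\<close> size about \<open>sqrt \<alpha>\<close>.
\<close>

section \<open>Moments of random samples\<close>

text \<open>The exponents come from one budget. A 0/1 variable of mean q has variance at most q, so
  samples of size about m / \<kappa> suffice where a bound blind to q would need m / \<kappa>^2.
  About L averaging steps, L being the logarithm in the statement, raise this to L^2 m / \<kappa>,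
  and each sampled point costs T a factor of up to exp L in density, so the rank is of order L^3 m /
  \<kappa>. A progression of length 4^m then fits into N residues once L^3 m^2 is small against
  \<kappa> log N; with \<kappa> about sqrt \<alpha> this yields the factors \<alpha>^(1/4) and (log
  N)^(1/2). The parameter \<epsilon> enters elsewhere: if A + B is concentrated, the good starting
  points may have density only about (sqrt \<alpha> / 4)^(2m), so the number of representations can
  drop by exp (O(L m)), which has to stay below N^\<epsilon>. Errors are measured relative to the
  L^(2m) norm of f itself: only then do the points at which f loses more than half its value along
  the progression account for a small part of that norm.\<close>

lemma power_avg_le_avg_power:
  fixes a :: "'i \<Rightarrow> real"
  assumes "finite S" "S \<noteq> {}"
  shows "((\<Sum>i\<in>S. a i) / card S) ^ (2*m) \<le> (\<Sum>i\<in>S. a i ^ (2*m)) / card S"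
proof -
  have c: "real (card S) > 0" using assms by (simp add: card_gt_0_iff)
  have "(\<Sum>i\<in>S. (1 / card S) *\<^sub>R a i) ^ (2*m) \<le> (\<Sum>i\<in>S. (1 / card S) * (a i) ^ (2*m))"
    by (rule convex_on_sum[OF assms convex_power_even[of "2*m"]]) (use c in auto)
  then show ?thesis by (simp add: sum_divide_distrib sum_distrib_left)
qed

text \<open>Convexity of the even power at the average of the three terms. The 3 on the left cancels
  later against three equal error bounds.\<close>

lemma power_sum3_le:
  fixes a b c :: real
  shows "3 * (a + b + c) ^ (2*m) \<le> 9 ^ m * (a ^ (2*m) + b ^ (2*m) + c ^ (2*m))"
proof -
  define g where "g = (\<lambda>i::nat. if i = 0 then a else if i = 1 then b else c)"
  have s: "{..<3::nat} = {0,1,2}" by auto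
  have "((\<Sum>i<3. g i) / real (card {..<3::nat})) ^ (2*m) \<le> (\<Sum>i<3. g i ^ (2*m)) / real (card {..<3::nat})"
    by (rule power_avg_le_avg_power) (auto simp: s)
  then have "((a+b+c)/3) ^ (2*m) \<le> (a ^ (2*m) + b ^ (2*m) + c ^ (2*m)) / 3"
    unfolding s by (simp add: g_def add.assoc)
  then have "(a+b+c) ^ (2*m) / 3 ^ (2*m) \<le> (a ^ (2*m) + b ^ (2*m) + c ^ (2*m)) / 3"
    by (simp only: power_divide)
  moreover have "(3::real) ^ (2*m) = 9 ^ m" by (simp add: power_mult)
  ultimately show ?thesis by (simp add: field_simps)
qed

lemma power_diff_le:
  fixes a b :: real
  shows "(a - b) ^ (2*m) \<le> 4 ^ m * (a ^ (2*m) + b ^ (2*m))"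
proof -
  define g where "g = (\<lambda>i::nat. if i = 0 then a else - b)"
  have s: "{..<2::nat} = {0,1}" by auto
  have "((\<Sum>i<2. g i) / real (card {..<2::nat})) ^ (2*m) \<le> (\<Sum>i<2. g i ^ (2*m)) / real (card {..<2::nat})"
    by (rule power_avg_le_avg_power) (auto simp: s)
  then have "((a-b)/2) ^ (2*m) \<le> (a ^ (2*m) + b ^ (2*m)) / 2"
    unfolding s by (simp add: g_def)
  also have "\<dots> \<le> a ^ (2*m) + b ^ (2*m)" by simp
  finally have "(a-b) ^ (2*m) / 2 ^ (2*m) \<le> a ^ (2*m) + b ^ (2*m)"
    by (simp only: power_divide)
  moreover have "(2::real) ^ (2*m) = 4 ^ m" by (simp add: power_mult)
  ultimately show ?thesis by (simp add: divide_le_eq mult.commute)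
qed

lemma exp_le_quadratic:
  fixes s :: real
  assumes "\<bar>s\<bar> \<le> 1"
  shows "exp s \<le> 1 + s + s\<^sup>2"
proof (cases "s \<ge> 0")
  case True
  then show ?thesis using exp_bound[of s] assms by auto
next
  case False
  define u where "u = - s"
  have u: "0 < u" "u \<le> 1" using False assms by (auto simp: u_def)
  have "1 + u \<le> exp u" by (rule exp_ge_add_one_self)
  then have "exp (-u) \<le> 1 / (1 + u)" using u by (simp add: exp_minus field_simps)
  also have "\<dots> \<le> 1 - u + u\<^sup>2"
  proof -
    have "(1 - u + u\<^sup>2) * (1 + u) = 1 + u ^ 3" by (simp add: algebra_simps power2_eq_square power3_eq_cube)
    then have "1 \<le> (1 - u + u\<^sup>2) * (1 + u)" using u by simp
    then show ?thesis using u by (simp add: divide_le_eq)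
  qed
  finally show ?thesis by (simp add: u_def)
qed

text \<open>A single term of the exponential series is at most its sum. Adding both signs turns
  bounds for exponential moments at s and -s into a bound for an even moment.\<close>

lemma even_power_le_exp:
  fixes y :: real
  shows "y ^ (2*m) \<le> fact (2*m) * (exp y + exp (-y))"
proof -
  have *: "y ^ (2*m) \<le> fact (2*m) * exp y" if "y \<ge> 0" for y :: real
  proof -
    have "(\<Sum>n<Suc(2*m). y ^ n /\<^sub>R fact n) \<le> (\<Sum>n. y ^ n /\<^sub>R fact n)"
      by (rule sum_le_suminf[OF summable_exp_generic]) (use that in auto)
    then have "(\<Sum>n<Suc(2*m). y ^ n /\<^sub>R fact n) \<le> exp y" by (simp add: exp_def)
    moreover have "y ^ (2*m) /\<^sub>R fact (2*m) \<le> (\<Sum>n<Suc(2*m). y ^ n /\<^sub>R fact n)"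
      by (rule member_le_sum) (use that in auto)
    ultimately have "y ^ (2*m) /\<^sub>R fact (2*m) \<le> exp y" by linarith
    then show ?thesis by (simp add: field_simps)
  qed
  show ?thesis
  proof (cases "y \<ge> 0")
    case True
    have "fact (2*m) * exp y \<le> fact (2*m) * (exp y + exp (-y))" by simp
    then show ?thesis using *[OF True] by linarith
  next
    case False
    then have "(-y) ^ (2*m) \<le> fact (2*m) * exp (-y)" by (intro *) auto
    moreover have "fact (2*m) * exp (-y) \<le> fact (2*m) * (exp y + exp (-y))" by simp
    ultimately show ?thesis by (simp only: power_mult power2_minus)
  qed
qed

text \<open>Samples are drawn with replacement, so the sum over them factorises. For a 0/1 value z,
  exp (s z) is affine in z, and each factor divided by \<open>card B\<close> is at most exp (q s^2):
  the exponent is proportional to the mean q and not merely of order s^2. This is where the sample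
  size m / \<kappa> comes from.\<close>

lemma exp_moment_sampling:
  fixes z :: "'b \<Rightarrow> real"
  assumes B: "finite B" "B \<noteq> {}" and z: "\<And>b. b \<in> B \<Longrightarrow> z b \<in> {0, 1}"
    and s: "\<bar>s\<bar> \<le> 1"
  defines "q \<equiv> (\<Sum>b\<in>B. z b) / card B"
  shows "(\<Sum>b\<in>{..<k::nat} \<rightarrow>\<^sub>E B. exp (s * (\<Sum>i<k. z (b i) - q))) \<le> real (card B) ^ k * exp (k * q * s\<^sup>2)"
proof -
  have c: "real (card B) > 0" using B by (simp add: card_gt_0_iff)
  have q0: "q \<ge> 0" unfolding q_def using z by (intro divide_nonneg_nonneg sum_nonneg) fastforce+
  have "(\<Sum>b\<in>{..<k::nat} \<rightarrow>\<^sub>E B. exp (s * (\<Sum>i<k. z (b i) - q)))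
      = (\<Sum>b\<in>{..<k::nat} \<rightarrow>\<^sub>E B. \<Prod>i<k. exp (s * (z (b i) - q)))"
    by (simp add: sum_distrib_left exp_sum)
  also have "\<dots> = (\<Prod>i<k. \<Sum>b\<in>B. exp (s * (z b - q)))"
    by (rule prod_sum_PiE[symmetric]) (use B in auto)
  also have "\<dots> = (\<Sum>b\<in>B. exp (s * (z b - q))) ^ k" by simp
  also have "\<dots> \<le> (card B * exp (q * s\<^sup>2)) ^ k"
  proof (rule power_mono)
    have "(\<Sum>b\<in>B. exp (s * (z b - q))) = (\<Sum>b\<in>B. exp (- s * q) * (1 + z b * (exp s - 1)))"
      by (rule sum.cong) (use z in \<open>force simp: algebra_simps exp_add exp_diff exp_minus field_simps\<close>)+
    also have "\<dots> = exp (- s * q) * (card B + (\<Sum>b\<in>B. z b) * (exp s - 1))"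
      by (simp add: sum_distrib_left[symmetric] sum_distrib_right[symmetric] sum.distrib)
    also have "(\<Sum>b\<in>B. z b) = q * card B" using c by (simp add: q_def)
    also have "card B + q * card B * (exp s - 1) = card B * (1 + q * (exp s - 1))"
      by (simp add: algebra_simps)
    also have "exp (- s * q) * (card B * (1 + q * (exp s - 1))) \<le> exp (- s * q) * (card B * exp (q * (exp s - 1)))"
      by (intro mult_left_mono exp_ge_add_one_self) (use c in auto)
    also have "\<dots> = card B * exp (q * (exp s - 1 - s))" by (simp add: exp_add[symmetric] algebra_simps mult.left_commute exp_diff exp_minus field_simps)
    also have "\<dots> \<le> card B * exp (q * s\<^sup>2)"
      using exp_le_quadratic[OF s] q0 c by (intro mult_left_mono) (auto intro: mult_left_mono)
    finally show "(\<Sum>b\<in>B. exp (s * (z b - q))) \<le> card B * exp (q * s\<^sup>2)" .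
  qed (auto intro: sum_nonneg)
  also have "\<dots> = real (card B) ^ k * exp (k * q * s\<^sup>2)"
    by (simp add: power_mult_distrib exp_of_nat_mult[symmetric] mult.assoc)
  finally show ?thesis .
qed

lemma moment_sampling:
  fixes z :: "'b \<Rightarrow> real"
  assumes B: "finite B" "B \<noteq> {}" and z: "\<And>b. b \<in> B \<Longrightarrow> z b \<in> {0, 1}"
    and s: "0 < s" "s \<le> 1"
  defines "q \<equiv> (\<Sum>b\<in>B. z b) / card B"
  shows "(\<Sum>b\<in>{..<k::nat} \<rightarrow>\<^sub>E B. (\<Sum>i<k. z (b i) - q) ^ (2*m))
     \<le> 2 * fact (2*m) / s ^ (2*m) * real (card B) ^ k * exp (k * q * s\<^sup>2)"
proof -
  let ?P = "{..<k::nat} \<rightarrow>\<^sub>E B"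
  have "s ^ (2*m) * (\<Sum>b\<in>?P. (\<Sum>i<k. z (b i) - q) ^ (2*m)) = (\<Sum>b\<in>?P. (s * (\<Sum>i<k. z (b i) - q)) ^ (2*m))"
    by (simp only: sum_distrib_left[symmetric] power_mult_distrib)
  also have "\<dots> \<le> (\<Sum>b\<in>?P. fact (2*m) * (exp (s * (\<Sum>i<k. z (b i) - q)) + exp ((-s) * (\<Sum>i<k. z (b i) - q))))"
    by (intro sum_mono) (use even_power_le_exp in \<open>simp only: minus_mult_left[symmetric]\<close>)
  also have "\<dots> = fact (2*m) * ((\<Sum>b\<in>?P. exp (s * (\<Sum>i<k. z (b i) - q))) + (\<Sum>b\<in>?P. exp ((-s) * (\<Sum>i<k. z (b i) - q))))"
    by (simp only: sum_distrib_left[symmetric] sum.distrib)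
  also have "\<dots> \<le> fact (2*m) * (real (card B) ^ k * exp (k * q * s\<^sup>2) + real (card B) ^ k * exp (k * q * (-s)\<^sup>2))"
    unfolding q_def by (intro mult_left_mono add_mono exp_moment_sampling B z) (use s in auto)
  also have "\<dots> = 2 * fact (2*m) * real (card B) ^ k * exp (k * q * s\<^sup>2)" by simp
  finally show ?thesis using s by (simp add: field_simps)
qed

lemma fact_le_square_power: "fact (2*m) \<le> (4 * real m ^ 2) ^ m"
proof -
  have "fact (2*m) \<le> (real ((2*m) ^ (2*m)))"
    by (metis fact_le_power)
  also have "\<dots> = (4 * real m ^ 2) ^ m" by (simp add: power_mult power_mult_distrib power2_eq_square)
  finally show ?thesis .
qed

text \<open>The scale \<open>s\<^sup>2 = m / (k max q \<kappa>)\<close> balances the two factors of the moment bound.\<close>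

lemma moment_sampling_mean:
  fixes z :: "'b \<Rightarrow> real"
  assumes B: "finite B" "B \<noteq> {}" and z: "\<And>b. b \<in> B \<Longrightarrow> z b \<in> {0, 1}"
    and m: "m \<ge> 1" and \<kappa>: "0 < \<kappa>" and \<delta>: "0 < \<delta>" "\<delta> \<le> 1" and k: "real m \<le> \<delta>\<^sup>2 * \<kappa> * k"
  defines "q \<equiv> (\<Sum>b\<in>B. z b) / card B"
  shows "(\<Sum>b\<in>{..<k::nat} \<rightarrow>\<^sub>E B. ((\<Sum>i<k. z (b i)) / k - q) ^ (2*m))
     \<le> 2 * (12 * \<delta>\<^sup>2) ^ m * (q ^ (2*m) + \<kappa> ^ (2*m)) * real (card B) ^ k"
proof -
  let ?P = "{..<k::nat} \<rightarrow>\<^sub>E B"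
  \<comment> \<open>The floor \<kappa> keeps s at most 1 where the mean q is tiny, at the price of
    the term \<open>\<kappa> ^ (2*m)\<close> in the bound.\<close>
  define M where "M = max q \<kappa>"
  have c: "real (card B) > 0" using B by (simp add: card_gt_0_iff)
  have q0: "q \<ge> 0" unfolding q_def using z by (intro divide_nonneg_nonneg sum_nonneg) fastforce+
  have M: "M > 0" "M \<ge> \<kappa>" "M \<ge> q" using \<kappa> by (auto simp: M_def)
  have kpos: "real k > 0" using k m \<kappa> \<delta> by (cases "k = 0") auto
  define s where "s = sqrt (m / (k * M))"
  have d2: "\<delta>\<^sup>2 \<le> 1" using \<delta> by (simp add: power_le_one)
  have "real m \<le> \<delta>\<^sup>2 * \<kappa> * k" by (rule k)
  also have "\<dots> \<le> \<kappa> * k" using d2 \<kappa> kpos by (simp add: mult_le_cancel_right1)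
  also have "\<dots> \<le> M * k" using M kpos by (simp add: mult_right_mono)
  finally have mk: "real m \<le> k * M" by (simp add: mult.commute)
  have s: "0 < s" "s \<le> 1" using m mk M kpos by (auto simp: s_def)
  have s2: "s\<^sup>2 = m / (k * M)" using m M kpos by (simp add: s_def)
  have "k * q * s\<^sup>2 = m * (q / M)" using s2 M kpos by simp
  also have "\<dots> \<le> m" using M q0 by (intro mult_left_le) (auto simp: divide_le_eq)
  finally have e: "exp (k * q * s\<^sup>2) \<le> 3 ^ m"
  proof -
    assume "k * q * s\<^sup>2 \<le> m"
    then have "exp (k * q * s\<^sup>2) \<le> exp (real m)" by simp
    also have "\<dots> = exp 1 ^ m" by (simp add: exp_of_nat_mult[symmetric])
    also have "\<dots> \<le> 3 ^ m" using exp_le by (intro power_mono) auto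
    finally show ?thesis .
  qed
  have f: "fact (2*m) / s ^ (2*m) \<le> (4 * m * (k * M)) ^ m"
  proof -
    have "fact (2*m) / s ^ (2*m) \<le> (4 * real m ^ 2) ^ m / s ^ (2*m)"
      by (intro divide_right_mono fact_le_square_power) (use s in auto)
    also have "\<dots> = (4 * real m ^ 2 / s\<^sup>2) ^ m" by (simp add: power_mult power_divide)
    also have "4 * real m ^ 2 / s\<^sup>2 = 4 * m * (k * M)" using m M kpos unfolding s2 by (simp add: field_simps power2_eq_square)
    finally show ?thesis .
  qed
  have scale: "real k * ((\<Sum>i<k. z (b i)) / k - q) = (\<Sum>i<k. z (b i) - q)" for b
    using kpos by (simp add: sum_subtractf right_diff_distrib)
  have "real k ^ (2*m) * (\<Sum>b\<in>?P. ((\<Sum>i<k. z (b i)) / k - q) ^ (2*m))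
      = (\<Sum>b\<in>?P. (real k * ((\<Sum>i<k. z (b i)) / k - q)) ^ (2*m))"
    by (simp only: power_mult_distrib sum_distrib_left[symmetric])
  also have "\<dots> = (\<Sum>b\<in>?P. (\<Sum>i<k. z (b i) - q) ^ (2*m))" by (simp only: scale)
  also have "\<dots> \<le> 2 * fact (2*m) / s ^ (2*m) * real (card B) ^ k * exp (k * q * s\<^sup>2)"
    unfolding q_def by (rule moment_sampling) (use B z s in auto)
  also have "\<dots> = 2 * (fact (2*m) / s ^ (2*m)) * exp (k * q * s\<^sup>2) * real (card B) ^ k" by simp
  also have "\<dots> \<le> 2 * ((4 * m * (k * M)) ^ m) * 3 ^ m * real (card B) ^ k"
    by (intro mult_right_mono mult_mono f e) (use s M in auto)
  also have "\<dots> = 2 * (12 * m * k * M) ^ m * real (card B) ^ k"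
  proof -
    have "(4 * m * (k * M)) ^ m * 3 ^ m = (4 * m * (k * M) * 3) ^ m" by (simp only: power_mult_distrib)
    also have "4 * m * (k * M) * 3 = 12 * m * k * M" by simp
    finally show ?thesis by (simp only: mult.assoc)
  qed
  also have "\<dots> \<le> 2 * (12 * (\<delta>\<^sup>2 * M * k) * k * M) ^ m * real (card B) ^ k"
  proof -
    have "real m \<le> \<delta>\<^sup>2 * M * k"
      using k M kpos \<delta> by (meson mult_left_mono mult_right_mono of_nat_0_le_iff order_trans zero_le_power2)
    then have "real m * real k \<le> \<delta>\<^sup>2 * M * k * real k" by (rule mult_right_mono) simp
    then show ?thesis using M by (intro mult_right_mono mult_left_mono power_mono) (auto simp: mult.assoc)
  qed
  also have "\<dots> = real k ^ (2*m) * (2 * (12 * \<delta>\<^sup>2) ^ m * M ^ (2*m) * real (card B) ^ k)"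
  proof -
    have "12 * (\<delta>\<^sup>2 * M * k) * k * M = (real k)\<^sup>2 * (12 * \<delta>\<^sup>2) * M\<^sup>2"
      by (simp add: power2_eq_square)
    then have "(12 * (\<delta>\<^sup>2 * M * k) * k * M) ^ m = real k ^ (2*m) * (12 * \<delta>\<^sup>2) ^ m * M ^ (2*m)"
      by (simp only: power_mult_distrib power_mult)
    then show ?thesis by (simp only: mult.assoc mult.left_commute)
  qed
  finally have "(\<Sum>b\<in>?P. ((\<Sum>i<k. z (b i)) / k - q) ^ (2*m)) \<le> 2 * (12 * \<delta>\<^sup>2) ^ m * M ^ (2*m) * real (card B) ^ k"
    using kpos by (subst (asm) mult_le_cancel_left_pos) auto
  also have "\<dots> \<le> 2 * (12 * \<delta>\<^sup>2) ^ m * (q ^ (2*m) + \<kappa> ^ (2*m)) * real (card B) ^ k"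
    using q0 \<kappa> by (intro mult_right_mono mult_left_mono) (auto simp: M_def max_def)
  finally show ?thesis .
qed

section \<open>Fourier analysis on cyclic groups\<close>

text \<open>Functions on \<open>\<int>/N\<int>\<close> are functions \<open>h\<close> on \<open>int\<close> with \<open>h (x mod N) = h x\<close>, summed over \<open>Z\<close>.\<close>

locale cyclic =
  fixes N :: int
  assumes N_pos: "0 < N"
begin

abbreviation Z :: "int set" where "Z \<equiv> {0..<N}"

lemma sum_shift:
  fixes F :: "int \<Rightarrow> 'a::comm_monoid_add"
  assumes "\<And>x. F (x mod N) = F x"
  shows "(\<Sum>x\<in>Z. F (x + t)) = (\<Sum>x\<in>Z. F x)"
proof (rule sum.reindex_bij_witness[of _ "\<lambda>x. (x - t) mod N" "\<lambda>x. (x + t) mod N"])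
  show "((a + t) mod N - t) mod N = a" if "a \<in> Z" for a
    using that by (simp add: mod_diff_left_eq)
  show "((b - t) mod N + t) mod N = b" if "b \<in> Z" for b
    using that by (simp add: mod_add_left_eq)
qed (use N_pos assms in auto)

definition chi :: "int \<Rightarrow> int \<Rightarrow> complex" where
  "chi r x = cis (2 * pi * (of_int r * of_int x / of_int N))"

lemma chi_commute: "chi r x = chi x r"
  by (simp add: chi_def mult.commute)

lemma chi_add: "chi r (x + y) = chi r x * chi r y"
  by (simp add: chi_def cis_mult algebra_simps add_divide_distrib)

lemma chi_add_left: "chi (r + s) x = chi r x * chi s x"
  by (metis chi_add chi_commute)

lemma norm_chi [simp]: "cmod (chi r x) = 1"
  by (simp add: chi_def)

lemma chi_zero [simp]: "chi r 0 = 1" "chi 0 x = 1"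
  by (simp_all add: chi_def)

lemma cnj_chi: "cnj (chi r x) = chi r (- x)"
  by (simp add: chi_def cis_cnj)

lemma chi_minus_left: "chi (- r) x = chi r (- x)"
  by (simp add: chi_def)

lemma chi_diff: "chi r (x - y) = chi r x * cnj (chi r y)"
  using chi_add[of r x "- y"] by (simp add: cnj_chi)

lemma chi_eq_1_iff: "chi r x = 1 \<longleftrightarrow> N dvd r * x"
proof -
  have "chi r x = 1 \<longleftrightarrow> (\<exists>n::int. 2 * pi * (of_int r * of_int x / of_int N) = of_int n * (2 * pi))"
    unfolding chi_def by (rule cis_eq_1_iff)
  also have "\<dots> \<longleftrightarrow> (\<exists>n::int. (of_int (r * x) :: real) = of_int (N * n))"
    using N_pos by (intro arg_cong[where f = Ex] ext) (auto simp: field_simps)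
  also have "\<dots> \<longleftrightarrow> N dvd r * x" by (auto simp only: of_int_eq_iff dvd_def)
  finally show ?thesis .
qed

lemma chi_mod [simp]: "chi r (x mod N) = chi r x"
proof -
  have "chi r x = chi r (x mod N + N * (x div N))" by simp
  also have "\<dots> = chi r (x mod N) * chi r (N * (x div N))" by (rule chi_add)
  also have "chi r (N * (x div N)) = 1" by (simp add: chi_eq_1_iff)
  finally show ?thesis by simp
qed

lemma sum_chi: "(\<Sum>x\<in>Z. chi r x) = (if N dvd r then of_int N else 0)"
proof (cases "N dvd r")
  case True
  then have "chi r x = 1" for x by (simp add: chi_eq_1_iff)
  then show ?thesis using True N_pos by simp
next
  case False
  have "(\<Sum>x\<in>Z. chi r x) = (\<Sum>x\<in>Z. chi r (x + 1))" by (rule sum_shift[symmetric]) simp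
  also have "\<dots> = (\<Sum>x\<in>Z. chi r x) * chi r 1" by (simp add: chi_add sum_distrib_right)
  finally have "(\<Sum>x\<in>Z. chi r x) * (chi r 1 - 1) = 0" by (simp add: algebra_simps)
  moreover have "chi r 1 \<noteq> 1" using False by (simp add: chi_eq_1_iff)
  ultimately show ?thesis using False by simp
qed

lemma eq_of_dvd_diff: "a \<in> Z \<Longrightarrow> b \<in> Z \<Longrightarrow> N dvd a - b \<longleftrightarrow> a = b"
  by (auto simp: mod_eq_dvd_iff[symmetric])

lemma parseval_set:
  assumes "A \<subseteq> Z"
  shows "(\<Sum>r\<in>Z. (cmod (\<Sum>a\<in>A. chi r a))\<^sup>2) = of_int N * card A"
proof -
  have fin: "finite A" using assms finite_subset by blast
  have "complex_of_real (\<Sum>r\<in>Z. (cmod (\<Sum>a\<in>A. chi r a))\<^sup>2)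
      = (\<Sum>r\<in>Z. (\<Sum>a\<in>A. chi r a) * cnj (\<Sum>b\<in>A. chi r b))"
    by (simp only: of_real_sum complex_norm_square)
  also have "\<dots> = (\<Sum>r\<in>Z. \<Sum>a\<in>A. \<Sum>b\<in>A. chi (a - b) r)"
    by (simp add: sum_product chi_diff chi_commute[of "_ - _"])
  also have "\<dots> = (\<Sum>a\<in>A. \<Sum>b\<in>A. \<Sum>r\<in>Z. chi (a - b) r)"
    by (simp only: sum.swap[of _ _ Z])
  also have "\<dots> = (\<Sum>a\<in>A. \<Sum>b\<in>A. if a = b then of_int N else 0)"
    using assms by (intro sum.cong refl) (auto simp: sum_chi eq_of_dvd_diff subset_iff)
  also have "\<dots> = complex_of_real (of_int N * card A)" using fin by simp
  finally show ?thesis by (simp only: of_real_eq_iff)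
qed

lemma parseval_set_neg:
  assumes "A \<subseteq> Z"
  shows "(\<Sum>r\<in>Z. (cmod (\<Sum>a\<in>A. chi r (- a)))\<^sup>2) = of_int N * card A"
proof -
  have "cmod (\<Sum>a\<in>A. chi r (- a)) = cmod (\<Sum>a\<in>A. chi r a)" for r
    by (metis (no_types, lifting) cnj_chi cnj_sum complex_mod_cnj sum.cong)
  then show ?thesis using parseval_set[OF assms] by simp
qed

definition ind :: "int set \<Rightarrow> int \<Rightarrow> real" where
  "ind A x = of_bool (x mod N \<in> A)"

text \<open>Normalised by \<open>card B\<close> and not by N: the value at x is the probability that
  x - b lies in A for a random b in B, which is what a sample of B estimates, and
  \<open>card B * conv A B x\<close> counts representations.\<close>

definition conv :: "int set \<Rightarrow> int set \<Rightarrow> int \<Rightarrow> real" where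
  "conv A B x = (\<Sum>b\<in>B. ind A (x - b)) / card B"

lemma ind_mod [simp]: "ind A (x mod N) = ind A x" by (simp add: ind_def)

lemma ind_mod_diff [simp]: "ind A (x mod N - t) = ind A (x - t)"
  by (simp add: ind_def mod_diff_left_eq)

lemma conv_mod [simp]: "conv A B (x mod N) = conv A B x" by (simp add: conv_def)

lemma conv_nonneg: "0 \<le> conv A B x"
  by (auto simp: conv_def ind_def intro!: divide_nonneg_nonneg sum_nonneg)

lemma conv_le_1: "conv A B x \<le> 1"
proof -
  have "(\<Sum>b\<in>B. ind A (x - b)) \<le> (\<Sum>b\<in>B. 1)" by (intro sum_mono) (simp add: ind_def)
  then show ?thesis by (cases "card B = 0") (simp_all add: conv_def divide_le_eq)
qed

lemma sum_ind: "A \<subseteq> Z \<Longrightarrow> (\<Sum>x\<in>Z. ind A x) = card A"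
proof -
  assume A: "A \<subseteq> Z"
  have "(\<Sum>x\<in>Z. ind A x) = (\<Sum>x\<in>Z. of_bool (x \<in> A))" by (intro sum.cong) (auto simp: ind_def)
  also have "\<dots> = card (Z \<inter> A)" by (simp add: of_bool_def sum.If_cases)
  also have "Z \<inter> A = A" using A by auto
  finally show ?thesis .
qed

lemma sum_conv:
  assumes "A \<subseteq> Z" "finite B" "B \<noteq> {}"
  shows "(\<Sum>x\<in>Z. conv A B x) = card A"
proof -
  have "(\<Sum>x\<in>Z. ind A (x - b)) = card A" for b
    using sum_shift[of "ind A" "- b"] sum_ind[OF assms(1)] by simp
  then have "(\<Sum>x\<in>Z. \<Sum>b\<in>B. ind A (x - b)) = card B * card A"
    by (subst sum.swap) simp
  then show ?thesis using assms by (simp add: conv_def sum_divide_distrib[symmetric])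
qed

text \<open>The bound on the absolute sum of the coefficients is what turns small changes of
  characters into uniformly small changes of functions. Parseval for both factors of
  \<open>w r\<close>, with 2xy \<le> x^2 + y^2, gives half of |A|/N + N/|B|, where the first term is
  at most 1 and the second at least 1. The bound enters the final estimates only through its
  logarithm.\<close>

lemma conv_fourier_expansion:
  assumes A: "A \<subseteq> Z" and B: "B \<subseteq> Z" "B \<noteq> {}"
  obtains w where "\<And>x. complex_of_real (conv A B x) = (\<Sum>r\<in>Z. w r * chi r x)"
    and "(\<Sum>r\<in>Z. cmod (w r)) \<le> of_int N / card B"
proof
  define u where "u r = (\<Sum>a\<in>A. chi r (- a)) / of_int N" for r
  define v where "v r = (\<Sum>b\<in>B. chi r (- b)) / card B" for r
  define w where "w r = u r * v r" for r
  have fin: "finite A" "finite B" using A B finite_subset by blast+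
  have cB: "real (card B) > 0" using fin B by (simp add: card_gt_0_iff)
  have cBN: "real (card B) \<le> of_int N"
    using card_mono[of Z B] B N_pos by simp
  have cAN: "real (card A) \<le> of_int N"
    using card_mono[of Z A] A N_pos by simp
  have inv: "complex_of_real (ind A x) = (\<Sum>r\<in>Z. u r * chi r x)" for x
  proof -
    have "(\<Sum>r\<in>Z. u r * chi r x) = (\<Sum>r\<in>Z. \<Sum>a\<in>A. chi (x - a) r) / of_int N"
      by (simp add: u_def sum_distrib_right sum_distrib_left sum_divide_distrib chi_commute[of "_ - _"] chi_diff cnj_chi mult.commute)
    also have "\<dots> = (\<Sum>a\<in>A. \<Sum>r\<in>Z. chi (x - a) r) / of_int N" by (subst sum.swap) simp
    also have "(\<Sum>a\<in>A. \<Sum>r\<in>Z. chi (x - a) r) = (\<Sum>a\<in>A. if a = x mod N then of_int N else 0)"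
    proof (rule sum.cong)
      fix a assume "a \<in> A"
      then have a: "a \<in> Z" using A by auto
      have "N dvd x - a \<longleftrightarrow> x mod N = a mod N" by (simp add: mod_eq_dvd_iff)
      then have "N dvd x - a \<longleftrightarrow> a = x mod N" using a by auto
      then show "(\<Sum>r\<in>Z. chi (x - a) r) = (if a = x mod N then of_int N else 0)" by (simp add: sum_chi)
    qed simp
    also have "\<dots> / of_int N = ind A x" using fin N_pos by (simp add: ind_def)
    finally show ?thesis by simp
  qed
  show "complex_of_real (conv A B x) = (\<Sum>r\<in>Z. w r * chi r x)" for x
  proof -
    have "complex_of_real (conv A B x) = (\<Sum>b\<in>B. \<Sum>r\<in>Z. u r * chi r (x - b)) / card B"
      by (simp add: conv_def inv)
    also have "\<dots> = (\<Sum>r\<in>Z. \<Sum>b\<in>B. u r * chi r (x - b)) / card B" by (subst sum.swap) simp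
    also have "\<dots> = (\<Sum>r\<in>Z. w r * chi r x)"
      by (simp add: w_def v_def sum_distrib_right sum_distrib_left sum_divide_distrib chi_diff cnj_chi algebra_simps)
    finally show ?thesis .
  qed
  have U: "(\<Sum>r\<in>Z. (cmod (u r))\<^sup>2) = card A / of_int N"
    using parseval_set_neg[OF A] N_pos
    by (simp add: u_def norm_divide power_divide sum_divide_distrib[symmetric] power2_eq_square)
  have V: "(\<Sum>r\<in>Z. (cmod (v r))\<^sup>2) = of_int N / card B"
    using parseval_set_neg[OF B(1)] cB
    by (simp add: v_def norm_divide power_divide sum_divide_distrib[symmetric] power2_eq_square)
  have "(\<Sum>r\<in>Z. cmod (w r)) \<le> (\<Sum>r\<in>Z. ((cmod (u r))\<^sup>2 + (cmod (v r))\<^sup>2) / 2)"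
  proof (rule sum_mono)
    fix r
    show "cmod (w r) \<le> ((cmod (u r))\<^sup>2 + (cmod (v r))\<^sup>2) / 2"
      using sum_squares_bound[of "cmod (u r)" "cmod (v r)"] by (simp add: w_def norm_mult)
  qed
  also have "\<dots> = (card A / of_int N + of_int N / card B) / 2"
    by (simp add: sum_divide_distrib[symmetric] sum.distrib U V)
  also have "\<dots> \<le> of_int N / card B"
  proof -
    have "(x + y) / 2 \<le> y" if "x \<le> 1" "1 \<le> y" for x y :: real using that by simp
    moreover have "card A / of_int N \<le> (1::real)" "of_int N / card B \<ge> (1::real)"
      using cAN cBN cB N_pos by auto
    ultimately show ?thesis by blast
  qed
  finally show "(\<Sum>r\<in>Z. cmod (w r)) \<le> of_int N / card B" .
qed

section \<open>Almost-periods\<close>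

text \<open>The Croot--Sisask argument: a typical \<open>k\<close>-point sample of \<open>B\<close> approximates \<open>conv A B\<close> in
  \<open>L\<^sup>2\<^sup>m\<close>, and some \<open>v\<close> is a translate of good samples by many different \<open>t\<close>, so that
  differences of such \<open>t\<close> are almost-periods.\<close>

lemma almost_periods:
  assumes A: "A \<subseteq> Z" and B: "B \<subseteq> Z" "B \<noteq> {}" and m: "m \<ge> 1" and \<kappa>: "0 < \<kappa>"
    and \<delta>: "0 < \<delta>" "\<delta> \<le> 1" and k: "real m \<le> \<delta>\<^sup>2 * \<kappa> * real k"
  defines "Q \<equiv> (\<Sum>x\<in>Z. conv A B x ^ (2*m))"
  assumes Q: "of_int N * \<kappa> ^ (2*m) \<le> Q"
  obtains T where "T \<subseteq> Z" "of_int N * real (card B) ^ k \<le> 2 * real (card T) * of_int N ^ k"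
    "\<And>t t'. t \<in> T \<Longrightarrow> t' \<in> T \<Longrightarrow>
      (\<Sum>x\<in>Z. (conv A B (x + (t - t')) - conv A B x) ^ (2*m)) \<le> (768 * \<delta>\<^sup>2) ^ m * Q"
proof -
  let ?f = "conv A B"
  define P where "P = ({..<k} \<rightarrow>\<^sub>E B)"
  define PZ where "PZ = ({..<k} \<rightarrow>\<^sub>E Z)"
  have finB: "finite B" using B finite_subset by blast
  have cB: "real (card B) > 0" using finB B by (simp add: card_gt_0_iff)
  have Qpos: "Q > 0" using Q \<kappa> N_pos by (smt (verit) mult_pos_pos of_int_0_less_iff zero_less_power)
  define S where "S b x = (\<Sum>i<k. ind A (x - b i)) / k" for b x
  define err where "err b = (\<Sum>x\<in>Z. (S b x - ?f x) ^ (2*m))" for b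
  have err_nonneg: "err b \<ge> 0" for b by (simp add: err_def sum_nonneg power_mult)
  \<comment> \<open>Twice the average of \<open>err\<close> over all samples is at most 8 (12
    \<delta>^2)^m Q, and 8 \<le> 8^m turns this into \<open>c\<close>; by Markov at least half of
    the samples are good.\<close>
  define c where "c = (96 * \<delta>\<^sup>2) ^ m * Q"
  define good where "good = {b \<in> P. err b \<le> c}"
  have finP: "finite P" using finB by (simp add: P_def finite_PiE)
  have cardP: "card P = card B ^ k" by (simp add: P_def card_PiE)
  have cpos: "c > 0" using Qpos \<delta> by (simp add: c_def)
  have two_m: "(2::real) ^ m \<ge> 2" using power_increasing[of 1 m "2::real"] m by simp
  have eight: "(8::real) ^ m \<ge> 8" using power_increasing[of 1 m "8::real"] m by simp
  have "(\<Sum>b\<in>P. err b) = (\<Sum>x\<in>Z. \<Sum>b\<in>P. (S b x - ?f x) ^ (2*m))"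
    unfolding err_def by (rule sum.swap)
  also have "\<dots> \<le> (\<Sum>x\<in>Z. 2 * (12 * \<delta>\<^sup>2) ^ m * (?f x ^ (2*m) + \<kappa> ^ (2*m)) * real (card B) ^ k)"
    unfolding S_def conv_def P_def
    by (intro sum_mono moment_sampling_mean finB B m \<kappa> \<delta> k) (simp add: ind_def)
  also have "\<dots> = 2 * (12 * \<delta>\<^sup>2) ^ m * (Q + of_int N * \<kappa> ^ (2*m)) * real (card B) ^ k"
    using N_pos by (simp add: sum_distrib_left[symmetric] sum_distrib_right[symmetric] sum.distrib Q_def)
  also have "\<dots> \<le> 2 * (12 * \<delta>\<^sup>2) ^ m * (Q + Q) * real (card B) ^ k"
    using Q by (intro mult_right_mono mult_left_mono) auto
  also have "\<dots> = 8 * (12 * \<delta>\<^sup>2) ^ m * Q * real (card B) ^ k / 2" by simp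
  also have "\<dots> \<le> 8 ^ m * (12 * \<delta>\<^sup>2) ^ m * Q * real (card B) ^ k / 2"
    using eight Qpos by (intro divide_right_mono mult_right_mono) auto
  also have "8 ^ m * (12 * \<delta>\<^sup>2) ^ m = (96 * \<delta>\<^sup>2) ^ m"
    by (simp only: power_mult_distrib[symmetric]) simp
  finally have tot: "(\<Sum>b\<in>P. err b) \<le> c * (real (card B) ^ k / 2)" by (simp add: c_def)
  have "c * real (card (P - good)) = (\<Sum>b\<in>P - good. c)" by (simp only: sum_constant mult.commute)
  also have "\<dots> \<le> (\<Sum>b\<in>P - good. err b)" by (rule sum_mono) (auto simp: good_def)
  also have "\<dots> \<le> (\<Sum>b\<in>P. err b)" by (rule sum_mono2) (use finP err_nonneg in auto)
  also note tot
  finally have bad: "real (card (P - good)) \<le> real (card B) ^ k / 2" using cpos by simp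
  have good_sub: "good \<subseteq> P" by (simp add: good_def)
  have "card (P - good) = card B ^ k - card good"
    using card_Diff_subset[OF finite_subset[OF good_sub finP] good_sub] cardP by simp
  moreover have "card good \<le> card B ^ k"
    using card_mono[OF finP good_sub] cardP by simp
  ultimately have cgood: "real (card B) ^ k \<le> 2 * real (card good)" using bad by (simp add: of_nat_diff)
  \<comment> \<open>The tuple v translated by -t, reduced mod N and kept extensional so that it can
    lie in \<open>P\<close>.\<close>
  define h where "h t v = restrict (\<lambda>i. (v i - t) mod N) {..<k}" for t :: int and v :: "nat \<Rightarrow> int"
  define Tv where "Tv v = {t \<in> Z. h t v \<in> good}" for v
  have finPZ: "finite PZ" by (simp add: PZ_def finite_PiE)
  have cardPZ: "real (card PZ) = of_int N ^ k" using N_pos by (simp add: PZ_def card_PiE)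
  have shift_count: "card good \<le> card {v \<in> PZ. h t v \<in> good}" for t
  proof (rule card_inj_on_le[where f = "\<lambda>b. restrict (\<lambda>i. (b i + t) mod N) {..<k}"])
    have *: "h t (restrict (\<lambda>i. (b i + t) mod N) {..<k}) = b" if "b \<in> good" for b
    proof
      fix i
      have "b \<in> P" using that by (simp add: good_def)
      then show "h t (restrict (\<lambda>i. (b i + t) mod N) {..<k}) i = b i"
        using B(1) by (cases "i < k") (auto simp: P_def h_def mod_diff_left_eq PiE_iff extensional_def subset_iff)
    qed
    show "inj_on (\<lambda>b. restrict (\<lambda>i. (b i + t) mod N) {..<k}) good"
      by (rule inj_on_inverseI[where g = "h t"]) (rule *)
    show "(\<lambda>b. restrict (\<lambda>i. (b i + t) mod N) {..<k}) ` good \<subseteq> {v \<in> PZ. h t v \<in> good}"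
      using * N_pos by (auto simp: PZ_def split: if_splits)
  qed (use finPZ in simp)
  \<comment> \<open>Pigeonhole over the pairs (t, v): every t in \<open>Z\<close> occurs with at
    least \<open>card good\<close> tuples v, and there are only N^k tuples.\<close>
  have "\<exists>v\<in>PZ. of_int N * real (card good) \<le> real (card (Tv v)) * of_int N ^ k"
  proof (rule ccontr)
    assume *: "\<not> ?thesis"
    have "of_int N * real (card good) = (\<Sum>t\<in>Z. real (card good))" using N_pos by simp
    also have "\<dots> \<le> (\<Sum>t\<in>Z. real (card {v \<in> PZ. h t v \<in> good}))"
      using shift_count by (intro sum_mono) simp
    also have "\<dots> = (\<Sum>t\<in>Z. \<Sum>v\<in>PZ. of_bool (h t v \<in> good))"
      using finPZ by (simp add: of_bool_def sum.If_cases Int_def)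
    also have "\<dots> = (\<Sum>v\<in>PZ. \<Sum>t\<in>Z. of_bool (h t v \<in> good))" by (rule sum.swap)
    also have "\<dots> = (\<Sum>v\<in>PZ. real (card (Tv v)))"
      by (simp add: of_bool_def sum.If_cases Int_def Tv_def)
    finally have le: "of_int N * real (card good) \<le> (\<Sum>v\<in>PZ. real (card (Tv v)))" .
    have "PZ \<noteq> {}" using N_pos by (auto simp: PZ_def PiE_eq_empty_iff)
    then have "(\<Sum>v\<in>PZ. real (card (Tv v)) * of_int N ^ k) < (\<Sum>v\<in>PZ. of_int N * real (card good))"
      using * finPZ by (intro sum_strict_mono) auto
    also have "\<dots> = of_int N ^ k * (of_int N * real (card good))" using cardPZ by simp
    finally have "(\<Sum>v\<in>PZ. real (card (Tv v))) * of_int N ^ k < (of_int N * real (card good)) * of_int N ^ k"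
      by (simp only: sum_distrib_right mult.commute[of "of_int N ^ k"])
    moreover have "(0::real) < of_int N ^ k" using N_pos by simp
    ultimately show False using le by (simp add: mult_less_cancel_right)
  qed
  then obtain v where v: "v \<in> PZ" "of_int N * real (card good) \<le> real (card (Tv v)) * of_int N ^ k" by blast
  \<comment> \<open>Sampling at translated points translates the sample average, so for good
    \<open>h t v\<close> the function \<open>S v (x + t)\<close> is close to f in the mean. Any two
    such t are thereby compared with the one function \<open>S v\<close>.\<close>
  have S_shift: "S (h t v) x = S v (x + t)" for t x
    unfolding S_def
  proof (intro arg_cong2[where f = "(/)"] sum.cong refl)
    fix i assume "i \<in> {..<k}"
    then have "ind A (x - h t v i) = ind A (x - (v i - t) mod N)" by (simp add: h_def)
    also have "\<dots> = ind A (x - (v i - t))" by (simp add: ind_def mod_diff_right_eq)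
    finally show "ind A (x - h t v i) = ind A (x + t - v i)" by (simp add: algebra_simps)
  qed
  show thesis
  proof
    show "Tv v \<subseteq> Z" by (auto simp: Tv_def)
    have "of_int N * real (card B) ^ k \<le> of_int N * (2 * real (card good))"
      using cgood N_pos by (intro mult_left_mono) auto
    also have "\<dots> \<le> 2 * (real (card (Tv v)) * of_int N ^ k)" using v(2) by simp
    finally show "of_int N * real (card B) ^ k \<le> 2 * real (card (Tv v)) * of_int N ^ k" by simp
    fix t t' assume t: "t \<in> Tv v" "t' \<in> Tv v"
    have close: "(\<Sum>x\<in>Z. (S v (x + s) - ?f x) ^ (2*m)) \<le> c" if "s \<in> Tv v" for s
      using that by (simp add: Tv_def good_def err_def S_shift)
    have S_mod: "S v (x mod N + s) = S v (x + s)" for x s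
      by (simp only: S_def ind_def add_diff_eq[symmetric] mod_add_left_eq)
    have "(\<Sum>x\<in>Z. (S v (x + t) - ?f (x + (t - t'))) ^ (2*m))
        = (\<Sum>x\<in>Z. (S v (x + (t - t') + t') - ?f (x + (t - t'))) ^ (2*m))" by (simp add: algebra_simps)
    also have "\<dots> = (\<Sum>x\<in>Z. (S v (x + t') - ?f x) ^ (2*m))"
      by (rule sum_shift[where F = "\<lambda>x. (S v (x + t') - ?f x) ^ (2*m)"]) (simp add: S_mod)
    also have "\<dots> \<le> c" by (rule close) (rule t)
    finally have 1: "(\<Sum>x\<in>Z. (S v (x + t) - ?f (x + (t - t'))) ^ (2*m)) \<le> c" .
    have "(\<Sum>x\<in>Z. (?f (x + (t - t')) - ?f x) ^ (2*m))
       = (\<Sum>x\<in>Z. ((S v (x + t) - ?f x) - (S v (x + t) - ?f (x + (t - t')))) ^ (2*m))" by simp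
    also have "\<dots> \<le> (\<Sum>x\<in>Z. 4 ^ m * ((S v (x + t) - ?f x) ^ (2*m) + (S v (x + t) - ?f (x + (t - t'))) ^ (2*m)))"
      by (intro sum_mono power_diff_le)
    also have "\<dots> \<le> 4 ^ m * (c + c)"
      using 1 close[OF t(1)] by (simp add: sum_distrib_left[symmetric] sum.distrib)
    also have "\<dots> = 4 ^ m * 2 * (96 * \<delta>\<^sup>2) ^ m * Q" by (simp add: c_def)
    also have "\<dots> \<le> 4 ^ m * 2 ^ m * (96 * \<delta>\<^sup>2) ^ m * Q"
      using two_m Qpos by (intro mult_right_mono mult_left_mono) auto
    also have "4 ^ m * 2 ^ m * (96 * \<delta>\<^sup>2) ^ m = (768 * \<delta>\<^sup>2) ^ m"
      by (simp only: power_mult_distrib[symmetric]) simp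
    finally show "(\<Sum>x\<in>Z. (?f (x + (t - t')) - ?f x) ^ (2*m)) \<le> (768 * \<delta>\<^sup>2) ^ m * Q" .
  qed
qed

text \<open>The base point t0 will be chosen in T, so that every shift t0 - t is a difference of two
  elements of T and hence an almost-period. On characters the operator is a multiplier whose modulus
  is that of the normalised Fourier transform of T.\<close>

definition avg :: "int set \<Rightarrow> int \<Rightarrow> (int \<Rightarrow> real) \<Rightarrow> int \<Rightarrow> real" where
  "avg T t0 h x = (\<Sum>t\<in>T. h (x + (t0 - t))) / card T"

lemma avg_mod:
  assumes "\<And>x. h (x mod N) = h x"
  shows "avg T t0 h (x mod N) = avg T t0 h x"
proof -
  have "h (x mod N + s) = h (x + s)" for s by (metis assms mod_add_left_eq)
  then show ?thesis by (simp add: avg_def)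
qed

lemma avg_diff: "avg T t0 (\<lambda>x. g x - h x) x = avg T t0 g x - avg T t0 h x"
  by (simp add: avg_def sum_subtractf diff_divide_distrib)

lemma sum_power_avg_le:
  assumes T: "finite T" "T \<noteq> {}" and h: "\<And>t. t \<in> T \<Longrightarrow> (\<Sum>x\<in>Z. h (x + (t0 - t)) ^ (2*m)) \<le> E"
  shows "(\<Sum>x\<in>Z. avg T t0 h x ^ (2*m)) \<le> E"
proof -
  have "(\<Sum>x\<in>Z. avg T t0 h x ^ (2*m)) \<le> (\<Sum>x\<in>Z. (\<Sum>t\<in>T. h (x + (t0 - t)) ^ (2*m)) / card T)"
    unfolding avg_def by (intro sum_mono power_avg_le_avg_power T)
  also have "\<dots> = (\<Sum>t\<in>T. \<Sum>x\<in>Z. h (x + (t0 - t)) ^ (2*m)) / card T"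
    by (simp add: sum_divide_distrib[symmetric] sum.swap[of _ T])
  also have "\<dots> \<le> (\<Sum>t\<in>T. E) / card T" by (intro divide_right_mono sum_mono h) auto
  also have "\<dots> = E" using T by simp
  finally show ?thesis .
qed

lemma sum_power_avg_le':
  assumes T: "finite T" "T \<noteq> {}" and h: "\<And>x. h (x mod N) = h x"
  shows "(\<Sum>x\<in>Z. avg T t0 h x ^ (2*m)) \<le> (\<Sum>x\<in>Z. h x ^ (2*m))"
proof (rule sum_power_avg_le[OF T])
  fix t
  show "(\<Sum>x\<in>Z. h (x + (t0 - t)) ^ (2*m)) \<le> (\<Sum>x\<in>Z. h x ^ (2*m))"
    using sum_shift[of "\<lambda>x. h x ^ (2*m)" "t0 - t"] h by simp
qed

text \<open>Averaging is linear and does not increase the L^(2m) norm, so each of the l successive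
  differences inherits the bound E of the first; telescoping and convexity then cost l^(2m).\<close>

lemma sum_power_iterate_avg_diff_le:
  assumes T: "finite T" "T \<noteq> {}" and f: "\<And>x. f (x mod N) = f x"
    and E: "\<And>t. t \<in> T \<Longrightarrow> (\<Sum>x\<in>Z. (f (x + (t0 - t)) - f x) ^ (2*m)) \<le> E"
  shows "(\<Sum>x\<in>Z. ((avg T t0 ^^ l) f x - f x) ^ (2*m)) \<le> real l ^ (2*m) * E"
proof (cases "l = 0")
  case True
  \<comment> \<open>For m = 0 the factor \<open>real l ^ (2*m)\<close> is 1 even with l = 0, so a
    lower bound for E is still needed; any single t supplies it.\<close>
  obtain t where "t \<in> T" using T by blast
  then show ?thesis using True E[of t] by (cases "m = 0") (simp_all add: power_0_left)
next
  case False
  let ?M = "avg T t0"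
  have per: "(?M ^^ i) f (x mod N) = (?M ^^ i) f x" for i x
    by (induction i arbitrary: x) (simp_all add: f avg_mod)
  have step: "(\<Sum>x\<in>Z. ((?M ^^ Suc i) f x - (?M ^^ i) f x) ^ (2*m)) \<le> E" for i
  proof (induction i)
    case 0
    have "f x = (\<Sum>t\<in>T. f x) / card T" for x using T by simp
    then have "(?M ^^ Suc 0) f x - (?M ^^ 0) f x = (\<Sum>t\<in>T. f (x + (t0 - t)) - f x) / card T" for x
      by (simp add: avg_def sum_subtractf diff_divide_distrib)
    then have "(\<Sum>x\<in>Z. ((?M ^^ Suc 0) f x - (?M ^^ 0) f x) ^ (2*m))
        \<le> (\<Sum>x\<in>Z. (\<Sum>t\<in>T. (f (x + (t0 - t)) - f x) ^ (2*m)) / card T)"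
      by (simp only:) (intro sum_mono power_avg_le_avg_power T)
    also have "\<dots> = (\<Sum>t\<in>T. \<Sum>x\<in>Z. (f (x + (t0 - t)) - f x) ^ (2*m)) / card T"
      by (simp add: sum_divide_distrib[symmetric] sum.swap[of _ T])
    also have "\<dots> \<le> (\<Sum>t\<in>T. E) / card T" by (intro divide_right_mono sum_mono E) auto
    also have "\<dots> = E" using T by simp
    finally show ?case .
  next
    case (Suc i)
    let ?d = "\<lambda>x. (?M ^^ Suc i) f x - (?M ^^ i) f x"
    have "(?M ^^ Suc (Suc i)) f x - (?M ^^ Suc i) f x = ?M ?d x" for x by (simp add: avg_diff)
    then have "(\<Sum>x\<in>Z. ((?M ^^ Suc (Suc i)) f x - (?M ^^ Suc i) f x) ^ (2*m)) = (\<Sum>x\<in>Z. ?M ?d x ^ (2*m))"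
      by (simp only:)
    also have "\<dots> \<le> (\<Sum>x\<in>Z. ?d x ^ (2*m))"
      by (rule sum_power_avg_le'[OF T]) (simp only: per)
    finally show ?case using Suc by linarith
  qed
  have l: "real l > 0" using False by simp
  have "(\<Sum>x\<in>Z. ((?M ^^ l) f x - f x) ^ (2*m))
      = (\<Sum>x\<in>Z. real l ^ (2*m) * ((\<Sum>i<l. (?M ^^ Suc i) f x - (?M ^^ i) f x) / card {..<l}) ^ (2*m))"
  proof (rule sum.cong)
    fix x
    have "(\<Sum>i<l. (?M ^^ Suc i) f x - (?M ^^ i) f x) = (?M ^^ l) f x - f x"
      by (subst sum_lessThan_telescope) simp
    then show "((?M ^^ l) f x - f x) ^ (2*m)
      = real l ^ (2*m) * ((\<Sum>i<l. (?M ^^ Suc i) f x - (?M ^^ i) f x) / card {..<l}) ^ (2*m)"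
      using l by (simp add: power_divide)
  qed simp
  also have "\<dots> \<le> (\<Sum>x\<in>Z. real l ^ (2*m) * ((\<Sum>i<l. ((?M ^^ Suc i) f x - (?M ^^ i) f x) ^ (2*m)) / card {..<l}))"
    by (intro sum_mono mult_left_mono power_avg_le_avg_power) (use False in \<open>auto simp: lessThan_empty_iff\<close>)
  also have "\<dots> = real l ^ (2*m) * ((\<Sum>i<l. \<Sum>x\<in>Z. ((?M ^^ Suc i) f x - (?M ^^ i) f x) ^ (2*m)) / l)"
    by (subst sum.swap) (simp only: sum_distrib_left[symmetric] sum_divide_distrib[symmetric] card_lessThan)
  also have "\<dots> \<le> real l ^ (2*m) * ((\<Sum>i<l. E) / l)"
    by (intro mult_left_mono divide_right_mono sum_mono step) auto
  also have "\<dots> = real l ^ (2*m) * E" using l by simp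
  finally show ?thesis .
qed

text \<open>Large spectrum at the fixed threshold 1/2. Frequencies outside it are damped by 1/2 at
  every averaging step, so for a given T iteration does the work of a lower threshold without
  enlarging the set to be spanned.\<close>

definition spec :: "int set \<Rightarrow> int set" where
  "spec T = {r \<in> Z. real (card T) \<le> 2 * cmod (\<Sum>t\<in>T. chi r t)}"

text \<open>The l-th iterate multiplies the coefficient of \<open>chi r\<close> by the l-th power of
  a multiplier of modulus at most 1. Characters in the spectrum change by at most \<omega> under the
  shift s; the others change by at most 2 but carry a factor (1/2)^l.\<close>

lemma iterate_avg_almost_invariant:
  assumes T: "finite T" "T \<noteq> {}"
    and f: "\<And>x. complex_of_real (f x) = (\<Sum>r\<in>Z. w r * chi r x)"
    and W: "(\<Sum>r\<in>Z. cmod (w r)) \<le> W"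
    and \<omega>: "0 \<le> \<omega>" "\<And>r. r \<in> spec T \<Longrightarrow> cmod (chi r s - 1) \<le> \<omega>"
  shows "\<bar>(avg T t0 ^^ l) f (x + s) - (avg T t0 ^^ l) f x\<bar> \<le> W * (2 * (1/2) ^ l + \<omega>)"
proof -
  define \<sigma> where "\<sigma> r = (\<Sum>t\<in>T. chi r (t0 - t)) / card T" for r
  have cT: "real (card T) > 0" using T by (simp add: card_gt_0_iff)
  have ex: "complex_of_real ((avg T t0 ^^ i) f y) = (\<Sum>r\<in>Z. w r * \<sigma> r ^ i * chi r y)" for i y
  proof (induction i arbitrary: y)
    case 0
    then show ?case by (simp add: f)
  next
    case (Suc i)
    have "complex_of_real ((avg T t0 ^^ Suc i) f y)
       = (\<Sum>t\<in>T. \<Sum>r\<in>Z. w r * \<sigma> r ^ i * chi r (y + (t0 - t))) / card T"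
      by (simp add: avg_def Suc)
    also have "\<dots> = (\<Sum>r\<in>Z. \<Sum>t\<in>T. w r * \<sigma> r ^ i * chi r (y + (t0 - t))) / card T"
      by (subst sum.swap) simp
    also have "\<dots> = (\<Sum>r\<in>Z. w r * \<sigma> r ^ i * \<sigma> r * chi r y)"
      by (simp add: \<sigma>_def chi_add sum_distrib_left[symmetric] sum_distrib_right[symmetric] mult.assoc)
         (simp add: mult_ac sum_divide_distrib)
    finally show ?case by (simp add: algebra_simps)
  qed
  have \<sigma>: "cmod (\<sigma> r) = cmod (\<Sum>t\<in>T. chi r t) / card T" for r
  proof -
    have "(\<Sum>t\<in>T. chi r (t0 - t)) = chi r t0 * cnj (\<Sum>t\<in>T. chi r t)"
      by (simp add: chi_diff sum_distrib_left)
    then have "cmod (\<Sum>t\<in>T. chi r (t0 - t)) = cmod (\<Sum>t\<in>T. chi r t)"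
      by (simp only: norm_mult norm_chi complex_mod_cnj mult_1_left)
    then show ?thesis by (simp add: \<sigma>_def norm_divide)
  qed
  have \<sigma>1: "cmod (\<sigma> r) \<le> 1" for r
  proof -
    have "cmod (\<Sum>t\<in>T. chi r t) \<le> (\<Sum>t\<in>T. cmod (chi r t))" by (rule norm_sum)
    then show ?thesis using cT by (simp add: \<sigma>)
  qed
  have coeff: "cmod (w r * \<sigma> r ^ l * (chi r s - 1)) \<le> cmod (w r) * (2 * (1/2) ^ l + \<omega>)" if r: "r \<in> Z" for r
  proof (cases "r \<in> spec T")
    case True
    have "cmod (\<sigma> r ^ l) * cmod (chi r s - 1) \<le> 1 * \<omega>"
      using \<sigma>1[of r] \<omega>(2)[OF True] by (intro mult_mono) (auto simp: norm_power power_le_one)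
    also have "\<dots> \<le> 2 * (1/2) ^ l + \<omega>" by simp
    finally show ?thesis by (simp add: norm_mult mult_left_mono mult.assoc)
  next
    case False
    then have "cmod (\<sigma> r) \<le> 1/2" using r cT by (simp add: spec_def \<sigma> field_simps)
    then have "cmod (\<sigma> r ^ l) \<le> (1/2) ^ l" by (simp only: norm_power) (rule power_mono, auto)
    moreover have "cmod (chi r s - 1) \<le> 2" using norm_triangle_ineq4[of "chi r s" 1] by simp
    ultimately have "cmod (\<sigma> r ^ l) * cmod (chi r s - 1) \<le> (1/2) ^ l * 2" by (intro mult_mono) auto
    also have "\<dots> \<le> 2 * (1/2) ^ l + \<omega>" using \<omega> by simp
    finally show ?thesis by (simp add: norm_mult mult_left_mono mult.assoc)
  qed
  have "complex_of_real ((avg T t0 ^^ l) f (x + s) - (avg T t0 ^^ l) f x)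
      = (\<Sum>r\<in>Z. (w r * \<sigma> r ^ l * (chi r s - 1)) * chi r x)"
    by (simp add: ex sum_subtractf[symmetric] chi_add algebra_simps)
  then have "\<bar>(avg T t0 ^^ l) f (x + s) - (avg T t0 ^^ l) f x\<bar>
      = cmod (\<Sum>r\<in>Z. (w r * \<sigma> r ^ l * (chi r s - 1)) * chi r x)" by (metis norm_of_real)
  also have "\<dots> \<le> (\<Sum>r\<in>Z. cmod (w r) * (2 * (1/2) ^ l + \<omega>))"
    by (rule sum_norm_le) (use coeff in \<open>simp add: norm_mult\<close>)
  also have "\<dots> = (\<Sum>r\<in>Z. cmod (w r)) * (2 * (1/2) ^ l + \<omega>)" by (simp add: sum_distrib_right)
  also have "\<dots> \<le> W * (2 * (1/2) ^ l + \<omega>)" using \<omega> by (intro mult_right_mono W) auto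
  finally show ?thesis .
qed

section \<open>Chang's theorem and Bohr sets\<close>

definition dissociated :: "int set \<Rightarrow> bool" where
  "dissociated \<Lambda> \<longleftrightarrow>
     (\<forall>\<epsilon>. (\<forall>r\<in>\<Lambda>. \<epsilon> r \<in> {-1, 0, 1}) \<and> N dvd (\<Sum>r\<in>\<Lambda>. \<epsilon> r * r) \<longrightarrow> (\<forall>r\<in>\<Lambda>. \<epsilon> r = 0))"

lemma chi_sum: "finite S \<Longrightarrow> chi (\<Sum>i\<in>S. g i) x = (\<Prod>i\<in>S. chi (g i) x)"
  by (induction S rule: finite_induct) (auto simp: chi_add_left)

text \<open>The chord of exp between -s and s. Its being affine in u is what lets a product of such
  factors expand into characters.\<close>

lemma exp_le_cosh_sinh:
  fixes u s :: real
  assumes "\<bar>u\<bar> \<le> 1"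
  shows "exp (s * u) \<le> cosh s + u * sinh s"
proof -
  have "exp ((1 - (1 + u) / 2) *\<^sub>R (- s) + ((1 + u) / 2) *\<^sub>R s)
      \<le> (1 - (1 + u) / 2) * exp (- s) + ((1 + u) / 2) * exp s"
    by (rule convex_onD[OF exp_convex]) (use assms in auto)
  then show ?thesis by (simp add: cosh_def sinh_def algebra_simps) (simp add: field_simps)
qed

lemma cosh_le_exp_square:
  fixes s :: real
  assumes "\<bar>s\<bar> \<le> 1"
  shows "cosh s \<le> exp (s\<^sup>2)"
proof -
  have "cosh s \<le> 1 + s\<^sup>2"
    using exp_le_quadratic[of s] exp_le_quadratic[of "- s"] assms by (simp add: cosh_def)
  also have "\<dots> \<le> exp (s\<^sup>2)" by (rule exp_ge_add_one_self)
  finally show ?thesis .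
qed

text \<open>For dissociated \<open>\<Lambda>\<close> the phases \<open>chi r\<close> behave like independent random variables
  (Riesz product), which bounds their joint exponential moment.\<close>

lemma exp_moment_dissociated:
  assumes fin: "finite \<Lambda>" and dis: "dissociated \<Lambda>" and c: "\<And>r. cmod (c r) \<le> 1" and s: "\<bar>s\<bar> \<le> 1"
  shows "(\<Sum>x\<in>Z. exp (\<Sum>r\<in>\<Lambda>. s * Re (c r * chi r x))) \<le> of_int N * exp (s\<^sup>2 * card \<Lambda>)"
proof -
  define w where "w r e = (if e = 0 then complex_of_real (cosh s)
      else if e = 1 then of_real (sinh s) * c r / 2 else of_real (sinh s) * cnj (c r) / 2)" for r and e :: int
  let ?E = "{-1, 0, 1 :: int}"
  have factor: "complex_of_real (cosh s + Re (c r * chi r x) * sinh s) = (\<Sum>e\<in>?E. w r e * chi (e * r) x)" for r x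
  proof -
    have "complex_of_real (Re (c r * chi r x)) = (c r * chi r x + cnj (c r) * chi (- r) x) / 2"
      using complex_add_cnj[of "c r * chi r x"] by (simp only: chi_minus_left cnj_chi complex_cnj_mult) simp
    moreover have "(\<Sum>e\<in>?E. w r e * chi (e * r) x)
        = of_real (cosh s) + (c r * chi r x + cnj (c r) * chi (- r) x) / 2 * of_real (sinh s)"
      by (simp add: w_def algebra_simps add_divide_distrib)
    ultimately show ?thesis by (simp only: of_real_add of_real_mult)
  qed
  have Re_le: "\<bar>Re (c r * chi r x)\<bar> \<le> 1" for r x
    using abs_Re_le_cmod[of "c r * chi r x"] c[of r] by (simp add: norm_mult)
  have "(\<Sum>x\<in>Z. exp (\<Sum>r\<in>\<Lambda>. s * Re (c r * chi r x)))
      \<le> (\<Sum>x\<in>Z. \<Prod>r\<in>\<Lambda>. cosh s + Re (c r * chi r x) * sinh s)"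
    unfolding exp_sum[OF fin]
    by (intro sum_mono prod_mono conjI exp_le_cosh_sinh Re_le) auto
  also have "\<dots> = of_int N * cosh s ^ card \<Lambda>"
  proof -
    have "complex_of_real (\<Sum>x\<in>Z. \<Prod>r\<in>\<Lambda>. cosh s + Re (c r * chi r x) * sinh s)
       = (\<Sum>x\<in>Z. \<Prod>r\<in>\<Lambda>. \<Sum>e\<in>?E. w r e * chi (e * r) x)"
      by (simp only: of_real_sum of_real_prod factor)
    also have "\<dots> = (\<Sum>x\<in>Z. \<Sum>\<epsilon>\<in>\<Lambda> \<rightarrow>\<^sub>E ?E. \<Prod>r\<in>\<Lambda>. w r (\<epsilon> r) * chi (\<epsilon> r * r) x)"
      using fin by (simp only: prod_sum_PiE finite.intros)
    also have "\<dots> = (\<Sum>x\<in>Z. \<Sum>\<epsilon>\<in>\<Lambda> \<rightarrow>\<^sub>E ?E. (\<Prod>r\<in>\<Lambda>. w r (\<epsilon> r)) * chi (\<Sum>r\<in>\<Lambda>. \<epsilon> r * r) x)"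
      using fin by (simp only: prod.distrib chi_sum)
    also have "\<dots> = (\<Sum>\<epsilon>\<in>\<Lambda> \<rightarrow>\<^sub>E ?E. (\<Prod>r\<in>\<Lambda>. w r (\<epsilon> r)) * (\<Sum>x\<in>Z. chi (\<Sum>r\<in>\<Lambda>. \<epsilon> r * r) x))"
      by (subst sum.swap) (simp only: sum_distrib_left)
    \<comment> \<open>Summing over x keeps only those \<epsilon> whose frequency is divisible by N;
      dissociativity leaves the zero choice alone.\<close>
    also have "\<dots> = (\<Sum>\<epsilon>\<in>\<Lambda> \<rightarrow>\<^sub>E ?E. if \<epsilon> = restrict (\<lambda>_. 0) \<Lambda> then of_real (cosh s) ^ card \<Lambda> * of_int N else 0)"
    proof (rule sum.cong)
      fix \<epsilon> assume \<epsilon>: "\<epsilon> \<in> \<Lambda> \<rightarrow>\<^sub>E ?E"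
      have eq: "\<epsilon> = restrict (\<lambda>_. 0) \<Lambda> \<longleftrightarrow> (\<forall>r\<in>\<Lambda>. \<epsilon> r = 0)"
        using \<epsilon> by (auto simp: PiE_iff extensional_def restrict_def fun_eq_iff)
      show "(\<Prod>r\<in>\<Lambda>. w r (\<epsilon> r)) * (\<Sum>x\<in>Z. chi (\<Sum>r\<in>\<Lambda>. \<epsilon> r * r) x)
          = (if \<epsilon> = restrict (\<lambda>_. 0) \<Lambda> then of_real (cosh s) ^ card \<Lambda> * of_int N else 0)"
      proof (cases "\<forall>r\<in>\<Lambda>. \<epsilon> r = 0")
        case True
        then have "(\<Prod>r\<in>\<Lambda>. w r (\<epsilon> r)) = of_real (cosh s) ^ card \<Lambda>" by (simp add: w_def)
        moreover have "(\<Sum>r\<in>\<Lambda>. \<epsilon> r * r) = 0" using True by simp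
        ultimately show ?thesis using True eq N_pos by (simp add: sum_chi)
      next
        case False
        have "\<forall>r\<in>\<Lambda>. \<epsilon> r \<in> ?E" using \<epsilon> by (auto simp: PiE_iff)
        then have "\<not> N dvd (\<Sum>r\<in>\<Lambda>. \<epsilon> r * r)" using False dis unfolding dissociated_def by blast
        then show ?thesis using False eq by (auto simp: sum_chi)
      qed
    qed simp
    also have "\<dots> = of_real (cosh s) ^ card \<Lambda> * of_int N"
    proof -
      have "restrict (\<lambda>_. 0) \<Lambda> \<in> \<Lambda> \<rightarrow>\<^sub>E ?E" by auto
      moreover have "finite (\<Lambda> \<rightarrow>\<^sub>E ?E)" using fin by (simp add: finite_PiE)
      ultimately show ?thesis by (simp only: sum.delta if_True)
    qed
    also have "\<dots> = complex_of_real (of_int N * cosh s ^ card \<Lambda>)" by simp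
    finally show ?thesis by (simp only: of_real_eq_iff)
  qed
  also have "\<dots> \<le> of_int N * exp (s\<^sup>2) ^ card \<Lambda>"
    using N_pos cosh_le_exp_square[OF s] by (intro mult_left_mono power_mono) auto
  also have "exp (s\<^sup>2) ^ card \<Lambda> = exp (s\<^sup>2 * card \<Lambda>)" by (simp add: exp_of_nat_mult[symmetric] mult.commute)
  finally show ?thesis .
qed

text \<open>Each character is twisted by the phase \<open>c r\<close> that makes its sum over T real
  and nonnegative. The resulting F has mean at least |\<Lambda>|/8 on T, so Jensen bounds exp
  (|\<Lambda>|/8) by the mean of exp F over T, hence by 1/|T| times its sum over all residues, which
  the Riesz product controls. The weight 1/4 maximises s/2 - s^2, leaving 1/16.\<close>

lemma chang_bound:
  assumes T: "T \<subseteq> Z" "T \<noteq> {}" and \<Lambda>: "\<Lambda> \<subseteq> spec T" "dissociated \<Lambda>"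
  shows "real (card T) * exp (card \<Lambda> / 16) \<le> of_int N"
proof -
  have finT: "finite T" using T finite_subset by blast
  have finL: "finite \<Lambda>" by (rule finite_subset[of _ Z]) (use \<Lambda>(1) in \<open>auto simp: spec_def\<close>)
  have cT: "real (card T) > 0" using finT T by (simp add: card_gt_0_iff)
  define \<tau> where "\<tau> r = (\<Sum>t\<in>T. chi r t)" for r
  define c where "c r = cnj (sgn (\<tau> r))" for r
  have c1: "cmod (c r) \<le> 1" for r by (simp add: c_def norm_sgn)
  have c\<tau>: "c r * \<tau> r = cmod (\<tau> r)" for r
    by (cases "\<tau> r = 0") (simp_all add: c_def sgn_eq complex_norm_square[symmetric] mult.commute power2_eq_square divide_simps)
  define F where "F x = (\<Sum>r\<in>\<Lambda>. 1/4 * Re (c r * chi r x))" for x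
  have "card \<Lambda> / 8 \<le> (\<Sum>t\<in>T. F t) / card T"
  proof -
    have "(\<Sum>t\<in>T. F t) = (\<Sum>r\<in>\<Lambda>. 1/4 * Re (c r * \<tau> r))"
      unfolding F_def \<tau>_def by (subst sum.swap) (simp add: sum_distrib_left Re_sum)
    also have "\<dots> = (\<Sum>r\<in>\<Lambda>. 1/4 * cmod (\<tau> r))" by (simp add: c\<tau>)
    also have "\<dots> \<ge> (\<Sum>r\<in>\<Lambda>. card T / 8)"
      by (intro sum_mono) (use \<Lambda>(1) in \<open>auto simp: spec_def \<tau>_def\<close>)
    finally show ?thesis using cT by (simp add: field_simps)
  qed
  then have "exp (card \<Lambda> / 8) \<le> exp ((\<Sum>t\<in>T. F t) / card T)" by simp
  also have "\<dots> \<le> (\<Sum>t\<in>T. exp (F t)) / card T"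
  proof -
    have "exp (\<Sum>t\<in>T. (1 / card T) *\<^sub>R F t) \<le> (\<Sum>t\<in>T. (1 / card T) * exp (F t))"
      by (rule convex_on_sum[OF finT T(2) exp_convex]) (use cT in auto)
    then show ?thesis by (simp add: sum_divide_distrib)
  qed
  also have "\<dots> \<le> (\<Sum>x\<in>Z. exp (F x)) / card T"
    by (intro divide_right_mono sum_mono2) (use T in auto)
  also have "\<dots> \<le> of_int N * exp ((1/4)\<^sup>2 * card \<Lambda>) / card T"
    unfolding F_def by (intro divide_right_mono exp_moment_dissociated finL \<Lambda> c1) auto
  finally have "card T * exp (card \<Lambda> / 8) \<le> of_int N * exp (card \<Lambda> / 16)"
    using cT by (simp add: field_simps power2_eq_square)
  moreover have "exp (card \<Lambda> / 8) = exp (card \<Lambda> / 16) * exp (real (card \<Lambda>) / 16)"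
    by (simp add: exp_add[symmetric])
  ultimately have "(card T * exp (card \<Lambda> / 16)) * exp (real (card \<Lambda>) / 16) \<le> of_int N * exp (card \<Lambda> / 16)"
    by (simp add: mult.assoc)
  then show ?thesis by simp
qed

text \<open>Take \<Lambda> maximal: adding a further r creates a relation in which r has coefficient
  1 or -1, so \<open>chi r\<close> is a product of characters \<open>chi q\<close> and their
  inverses, and distances to 1 are subadditive over products of phases.\<close>

lemma dissociated_spanning:
  assumes "finite S"
  obtains \<Lambda> where "\<Lambda> \<subseteq> S" "dissociated \<Lambda>"
    "\<And>r s. r \<in> S \<Longrightarrow> cmod (chi r s - 1) \<le> (\<Sum>q\<in>\<Lambda>. cmod (chi q s - 1))"
proof -
  define F where "F = {\<Lambda>. \<Lambda> \<subseteq> S \<and> dissociated \<Lambda>}"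
  have "finite F" using assms by (simp add: F_def)
  moreover have "{} \<in> F" by (simp add: F_def dissociated_def)
  ultimately obtain \<Lambda> where L: "\<Lambda> \<in> F" and max: "\<And>M. M \<in> F \<Longrightarrow> \<Lambda> \<subseteq> M \<Longrightarrow> \<Lambda> = M"
    by (metis finite_has_maximal empty_iff)
  have LS: "\<Lambda> \<subseteq> S" "dissociated \<Lambda>" using L by (auto simp: F_def)
  have finL: "finite \<Lambda>" using LS assms finite_subset by blast
  show thesis
  proof
    show "\<Lambda> \<subseteq> S" "dissociated \<Lambda>" by (rule LS)+
    fix r s assume r: "r \<in> S"
    have flip: "cmod (chi (- q) s - 1) = cmod (chi q s - 1)" for q
      by (metis chi_minus_left cnj_chi complex_cnj_diff complex_cnj_one complex_mod_cnj)
    have coeff: "cmod (chi (- (e * q)) s - 1) \<le> cmod (chi q s - 1)" if "e \<in> {-1, 0, 1}" for e q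
      using that flip[of q] by auto
    show "cmod (chi r s - 1) \<le> (\<Sum>q\<in>\<Lambda>. cmod (chi q s - 1))"
    proof (cases "r \<in> \<Lambda>")
      case True
      then show ?thesis using finL by (intro member_le_sum) auto
    next
      case False
      have "insert r \<Lambda> \<notin> F" using max[of "insert r \<Lambda>"] False by blast
      then have "\<not> dissociated (insert r \<Lambda>)" using r LS by (simp add: F_def)
      then obtain \<epsilon> where \<epsilon>: "\<forall>q\<in>insert r \<Lambda>. \<epsilon> q \<in> {-1, 0, 1}"
        "N dvd (\<Sum>q\<in>insert r \<Lambda>. \<epsilon> q * q)" "\<not> (\<forall>q\<in>insert r \<Lambda>. \<epsilon> q = 0)"
        unfolding dissociated_def by blast
      have sum: "(\<Sum>q\<in>insert r \<Lambda>. \<epsilon> q * q) = \<epsilon> r * r + (\<Sum>q\<in>\<Lambda>. \<epsilon> q * q)"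
        using False finL by simp
      have "\<epsilon> r \<noteq> 0"
      proof
        assume "\<epsilon> r = 0"
        then have "\<forall>q\<in>\<Lambda>. \<epsilon> q = 0" using LS(2) \<epsilon> sum unfolding dissociated_def by auto
        then show False using \<open>\<epsilon> r = 0\<close> \<epsilon> by auto
      qed
      then have er: "\<epsilon> r = 1 \<or> \<epsilon> r = -1" using \<epsilon>(1) by auto
      have "chi (\<epsilon> r * r + (\<Sum>q\<in>\<Lambda>. \<epsilon> q * q)) s = 1"
        using \<epsilon>(2) sum by (simp add: chi_eq_1_iff)
      then have one: "chi (\<epsilon> r * r) s * chi (\<Sum>q\<in>\<Lambda>. \<epsilon> q * q) s = 1" by (simp add: chi_add_left)
      have "chi (\<Sum>q\<in>\<Lambda>. \<epsilon> q * q) s * chi (\<Sum>q\<in>\<Lambda>. - (\<epsilon> q * q)) s = 1"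
        by (simp add: chi_add_left[symmetric] sum_negf)
      then have "chi (\<epsilon> r * r) s
          = chi (\<epsilon> r * r) s * (chi (\<Sum>q\<in>\<Lambda>. \<epsilon> q * q) s * chi (\<Sum>q\<in>\<Lambda>. - (\<epsilon> q * q)) s)"
        by (simp only: mult_1_right)
      also have "\<dots> = chi (\<Sum>q\<in>\<Lambda>. - (\<epsilon> q * q)) s"
        by (simp only: mult.assoc[symmetric] one mult_1_left)
      also have "\<dots> = (\<Prod>q\<in>\<Lambda>. chi (- (\<epsilon> q * q)) s)" by (rule chi_sum) (rule finL)
      finally have eq: "chi (\<epsilon> r * r) s = (\<Prod>q\<in>\<Lambda>. chi (- (\<epsilon> q * q)) s)" .
      have "cmod (chi r s - 1) = cmod (chi (\<epsilon> r * r) s - 1)" using er flip[of r] by auto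
      also have "\<dots> = cmod ((\<Prod>q\<in>\<Lambda>. chi (- (\<epsilon> q * q)) s) - (\<Prod>q\<in>\<Lambda>. 1))" by (simp add: eq)
      also have "\<dots> \<le> (\<Sum>q\<in>\<Lambda>. cmod (chi (- (\<epsilon> q * q)) s - 1))" by (rule norm_prod_diff) auto
      also have "\<dots> \<le> (\<Sum>q\<in>\<Lambda>. cmod (chi q s - 1))"
        using \<epsilon>(1) by (intro sum_mono coeff) auto
      finally show ?thesis .
    qed
  qed
qed

section \<open>Simultaneous Diophantine approximation\<close>

lemma norm_cis_diff_1_le: "cmod (cis t - 1) \<le> \<bar>t\<bar>"
proof -
  have "cmod (cis t - 1) = 2 * \<bar>sin (t / 2)\<bar>"
    using dist_exp_i_1[of t] by (simp add: cis_conv_exp)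
  also have "\<dots> \<le> 2 * \<bar>t / 2\<bar>" using abs_sin_x_le_abs_x[of "t / 2"] by linarith
  finally show ?thesis by simp
qed

text \<open>Dirichlet approximates all r / N at once within 1 / K, and 2 pi < 7. The error at the
  j-th multiple of q grows only linearly in j, which makes q usable as the step of a progression;
  the bound on q later keeps the progression inside one period.\<close>

lemma simultaneous_small_phases:
  assumes fin: "finite \<Lambda>" and K: "K > 0"
  obtains q where "0 < q" "q \<le> int K ^ card \<Lambda>"
    "\<And>r j. r \<in> \<Lambda> \<Longrightarrow> cmod (chi r (int j * q) - 1) \<le> 7 * real j / real K"
proof -
  obtain e where e: "bij_betw e {0..<card \<Lambda>} \<Lambda>" using ex_bij_betw_nat_finite[OF fin] by blast
  obtain q p where q: "0 < q" "q \<le> int (K ^ card \<Lambda>)"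
    and a: "\<And>i. i < card \<Lambda> \<Longrightarrow> \<bar>of_int q * (of_int (e i) / of_int N) - of_int (p i)\<bar> < (1::real) / K"
    using Dirichlet_approx_simult[OF K, of "card \<Lambda>" "\<lambda>i. of_int (e i) / of_int N"] by blast
  show thesis
  proof
    show "0 < q" "q \<le> int K ^ card \<Lambda>" using q by simp_all
    fix r and j :: nat assume "r \<in> \<Lambda>"
    then have "r \<in> e ` {0..<card \<Lambda>}" using e by (simp add: bij_betw_def)
    then obtain i where i: "i < card \<Lambda>" "e i = r" by auto
    define t :: real where "t = of_int q * (of_int r / of_int N) - of_int (p i)"
    have t: "\<bar>t\<bar> \<le> 1 / K" using a[OF i(1)] i(2) by (simp add: t_def)
    have "2 * pi * (of_int r * of_int q / of_int N) = 2 * pi * t + 2 * pi * of_int (p i)"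
      by (simp add: t_def algebra_simps)
    then have "chi r q = cis (2 * pi * t)" by (simp add: chi_def cis_mult[symmetric])
    then have "cmod (chi r q - 1) \<le> 2 * pi * \<bar>t\<bar>"
      using norm_cis_diff_1_le[of "2 * pi * t"] by (simp add: abs_mult)
    also have "\<dots> \<le> 7 * (1 / K)"
      using t pi_less_4 pi_approx by (intro mult_mono) auto
    finally have base: "cmod (chi r q - 1) \<le> 7 / K" by simp
    have "chi r (int j * q) = chi r q ^ j"
      by (induction j) (simp_all add: algebra_simps chi_add)
    then have "cmod (chi r (int j * q) - 1) = cmod (chi r q ^ j - 1 ^ j)" by simp
    also have "\<dots> \<le> real j * cmod (chi r q - 1)" by (rule norm_power_diff) auto
    also have "\<dots> \<le> real j * (7 / K)" by (intro mult_left_mono base) auto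
    finally show "cmod (chi r (int j * q) - 1) \<le> 7 * real j / real K" by (simp add: mult.commute)
  qed
qed

section \<open>Long progressions in sumsets\<close>

text \<open>f(x + s) is compared with f(x) through the smoothed function g. The two outer
  differences are small in the mean because differences of elements of T are almost-periods; the
  middle one is small at every point because s nearly fixes the spectrum of T.\<close>

lemma long_progression_of_almost_periods:
  assumes A: "A \<subseteq> Z" and B: "B \<subseteq> Z" "B \<noteq> {}" and m: "m \<ge> 1" and \<kappa>: "0 < \<kappa>"
  defines "Q \<equiv> (\<Sum>x\<in>Z. conv A B x ^ (2*m))"
  assumes Q: "of_int N * \<kappa> ^ (2*m) \<le> Q" and l: "l \<ge> 1" and K: "K \<ge> 1"
    and k: "490000 * (real l)\<^sup>2 * real m \<le> \<kappa> * real k"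
    and hl: "of_int N / card B * (2 * (1/2) ^ l) \<le> \<kappa> / 48"
    and D: "16 * ln (2 * (of_int N / card B) ^ k) \<le> real D"
    and hK: "of_int N / card B * (real D * (7 * real n / real K)) \<le> \<kappa> / 48"
    and fits: "real n * real K ^ D \<le> of_int N"
  obtains q where "0 < q" "int n * q \<le> N"
    "\<And>j. j < n \<Longrightarrow> (\<Sum>x\<in>Z. (conv A B (x + int j * q) - conv A B x) ^ (2*m)) \<le> Q / 64 ^ m"
proof -
  let ?f = "conv A B"
  have finB: "finite B" using B finite_subset by blast
  have cB: "real (card B) > 0" using finB B by (simp add: card_gt_0_iff)
  have Np: "(of_int N :: real) > 0" using N_pos by simp
  \<comment> \<open>The l averaging steps then cost the factor 768 l^2 \<delta>^2 = 768/490000 \<le>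
    1/576. The target 576 = 9 * 64 leaves 1/64 once three errors are combined at the price 9^m, and
    the uniform error \<kappa> / 24 matches it since 24^2 = 576.\<close>
  define \<delta> where "\<delta> = 1 / (700 * real l)"
  have \<delta>: "0 < \<delta>" "\<delta> \<le> 1" using l by (auto simp: \<delta>_def)
  have "real m \<le> \<delta>\<^sup>2 * \<kappa> * real k"
  proof -
    have "\<delta>\<^sup>2 * \<kappa> * real k = (\<kappa> * real k) / (490000 * (real l)\<^sup>2)"
      by (simp add: \<delta>_def power_divide power_mult_distrib)
    then show ?thesis using k l by (simp add: le_divide_eq mult.commute)
  qed
  then obtain T where T: "T \<subseteq> Z" "of_int N * real (card B) ^ k \<le> 2 * real (card T) * of_int N ^ k"
    "\<And>t t'. t \<in> T \<Longrightarrow> t' \<in> T \<Longrightarrow>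
      (\<Sum>x\<in>Z. (?f (x + (t - t')) - ?f x) ^ (2*m)) \<le> (768 * \<delta>\<^sup>2) ^ m * Q"
    using almost_periods[OF A B m \<kappa> \<delta>, of k] Q unfolding Q_def by blast
  have "0 < of_int N * real (card B) ^ k" using cB Np by simp
  with T(2) have Tpos: "real (card T) > 0" using Np by (smt (verit) mult_eq_0_iff of_nat_0_le_iff)
  then have T': "finite T" "T \<noteq> {}" by (auto simp: card_gt_0_iff)
  obtain t0 where t0: "t0 \<in> T" using T' by blast
  define g where "g = (avg T t0 ^^ l) ?f"
  have Qpos: "Q > 0" using Q \<kappa> Np by (smt (verit) mult_pos_pos zero_less_power)
  have g_mod: "g (x mod N) = g x" for x
    unfolding g_def by (induction l arbitrary: x) (simp_all add: avg_mod)
  have gf: "(\<Sum>x\<in>Z. (g x - ?f x) ^ (2*m)) \<le> Q / 576 ^ m"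
  proof -
    have "(\<Sum>x\<in>Z. (g x - ?f x) ^ (2*m)) \<le> real l ^ (2*m) * ((768 * \<delta>\<^sup>2) ^ m * Q)"
      unfolding g_def by (rule sum_power_iterate_avg_diff_le[OF T']) (use T(3)[OF t0] in auto)
    also have "\<dots> = (real l ^ 2 * (768 * \<delta>\<^sup>2)) ^ m * Q"
      by (simp only: power_mult_distrib power_mult mult.assoc)
    also have "real l ^ 2 * (768 * \<delta>\<^sup>2) = 768 / 490000"
      using l by (simp add: \<delta>_def power_divide power_mult_distrib)
    also have "(768 / 490000) ^ m * Q \<le> (1 / 576) ^ m * Q"
      using Qpos by (intro mult_right_mono power_mono) auto
    finally show ?thesis by (simp add: power_divide)
  qed
  have "finite (spec T)" by (rule finite_subset[of _ Z]) (auto simp: spec_def)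
  then obtain \<Lambda> where L: "\<Lambda> \<subseteq> spec T" "dissociated \<Lambda>"
    "\<And>r s. r \<in> spec T \<Longrightarrow> cmod (chi r s - 1) \<le> (\<Sum>q\<in>\<Lambda>. cmod (chi q s - 1))"
    using dissociated_spanning by blast
  have finL: "finite \<Lambda>" by (rule finite_subset[of _ Z]) (use L(1) in \<open>auto simp: spec_def\<close>)
  \<comment> \<open>The lower bound on |T| from sampling makes N/|T| at most 2 (N/|B|)^k; Chang's
    bound is 16 times the logarithm of N/|T|.\<close>
  have cardL: "card \<Lambda> \<le> D"
  proof -
    have "real (card T) * exp (card \<Lambda> / 16) * (of_int N ^ k * 2) \<le> of_int N * (of_int N ^ k * 2)"
      using chang_bound[OF T(1) T'(2) L(1,2)] Np by (intro mult_right_mono) auto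
    moreover have "of_int N * real (card B) ^ k * exp (card \<Lambda> / 16) \<le> 2 * real (card T) * of_int N ^ k * exp (card \<Lambda> / 16)"
      by (rule mult_right_mono[OF T(2)]) simp
    ultimately have "of_int N * (real (card B) ^ k * exp (card \<Lambda> / 16)) \<le> of_int N * (of_int N ^ k * 2)"
      by (simp only: mult_ac)
    then have "real (card B) ^ k * exp (card \<Lambda> / 16) \<le> of_int N ^ k * 2" using Np by simp
    then have "exp (card \<Lambda> / 16) \<le> 2 * (of_int N / card B) ^ k"
      using cB by (simp add: power_divide field_simps)
    then have "card \<Lambda> / 16 \<le> ln (2 * (of_int N / card B) ^ k)"
      using Np cB by (intro iffD2[OF ln_ge_iff]) auto
    then show ?thesis using D by simp
  qed
  obtain q where q: "0 < q" "q \<le> int K ^ card \<Lambda>"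
    "\<And>r j. r \<in> \<Lambda> \<Longrightarrow> cmod (chi r (int j * q) - 1) \<le> 7 * real j / real K"
    using simultaneous_small_phases[OF finL, of K] K by auto
  show thesis
  proof
    show "0 < q" by (rule q)
    have "int K ^ card \<Lambda> \<le> int K ^ D" using K cardL by (intro power_increasing) auto
    then have "int n * q \<le> int n * int K ^ D" using q(2) by (intro mult_left_mono) auto
    also have "\<dots> \<le> N"
    proof -
      have "real_of_int (int n * int K ^ D) \<le> real_of_int N" using fits by simp
      then show ?thesis by (simp only: of_int_le_iff)
    qed
    finally show "int n * q \<le> N" .
    fix j assume j: "j < n"
    let ?s = "int j * q"
    obtain w where w: "\<And>x. complex_of_real (?f x) = (\<Sum>r\<in>Z. w r * chi r x)"
      "(\<Sum>r\<in>Z. cmod (w r)) \<le> of_int N / card B"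
      using conv_fourier_expansion[OF A B] by blast
    define \<omega> where "\<omega> = real D * (7 * real n / real K)"
    have g_close: "\<bar>g (x + ?s) - g x\<bar> \<le> \<kappa> / 24" for x
    proof -
      have "\<bar>g (x + ?s) - g x\<bar> \<le> of_int N / card B * (2 * (1/2) ^ l + \<omega>)"
        unfolding g_def
      proof (rule iterate_avg_almost_invariant[OF T' w])
        show "0 \<le> \<omega>" by (simp add: \<omega>_def)
        fix r assume "r \<in> spec T"
        then have "cmod (chi r ?s - 1) \<le> (\<Sum>p\<in>\<Lambda>. cmod (chi p ?s - 1))" by (rule L(3))
        also have "\<dots> \<le> (\<Sum>p\<in>\<Lambda>. 7 * real n / real K)"
        proof (rule sum_mono)
          fix p assume "p \<in> \<Lambda>"
          then have "cmod (chi p ?s - 1) \<le> 7 * real j / real K" by (rule q(3))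
          also have "\<dots> \<le> 7 * real n / real K" using j by (intro divide_right_mono) auto
          finally show "cmod (chi p ?s - 1) \<le> 7 * real n / real K" .
        qed
        also have "\<dots> = real (card \<Lambda>) * (7 * real n / real K)" by simp
        also have "\<dots> \<le> \<omega>" unfolding \<omega>_def using cardL by (intro mult_right_mono) auto
        finally show "cmod (chi r ?s - 1) \<le> \<omega>" .
      qed
      also have "\<dots> \<le> \<kappa> / 24" using hl hK by (simp add: distrib_left \<omega>_def)
      finally show ?thesis .
    qed
    have g_pow: "(g (x + ?s) - g x) ^ (2*m) \<le> \<kappa> ^ (2*m) / 576 ^ m" for x
    proof -
      have "(g (x + ?s) - g x) ^ (2*m) = \<bar>g (x + ?s) - g x\<bar> ^ (2*m)" by (simp add: power_even_abs)
      also have "\<dots> \<le> (\<kappa> / 24) ^ (2*m)" by (intro power_mono g_close) auto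
      also have "(24::real) ^ (2*m) = 576 ^ m" by (simp add: power_mult)
      then have "(\<kappa> / 24) ^ (2*m) = \<kappa> ^ (2*m) / 576 ^ m" by (simp only: power_divide)
      finally show ?thesis .
    qed
    have shifted: "(\<Sum>x\<in>Z. (?f (x + ?s) - g (x + ?s)) ^ (2*m)) \<le> Q / 576 ^ m"
    proof -
      have "(\<Sum>x\<in>Z. (?f (x + ?s) - g (x + ?s)) ^ (2*m)) = (\<Sum>x\<in>Z. (?f x - g x) ^ (2*m))"
        by (rule sum_shift[where F = "\<lambda>x. (?f x - g x) ^ (2*m)"]) (simp add: g_mod)
      also have "\<dots> = (\<Sum>x\<in>Z. (g x - ?f x) ^ (2*m))" by (simp add: power_mult power2_commute)
      finally show ?thesis using gf by simp
    qed
    have "3 * (\<Sum>x\<in>Z. (?f (x + ?s) - ?f x) ^ (2*m))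
       = (\<Sum>x\<in>Z. 3 * ((?f (x + ?s) - g (x + ?s)) + (g (x + ?s) - g x) + (g x - ?f x)) ^ (2*m))"
      by (simp add: sum_distrib_left)
    also have "\<dots> \<le> (\<Sum>x\<in>Z. 9 ^ m * ((?f (x + ?s) - g (x + ?s)) ^ (2*m) + (g (x + ?s) - g x) ^ (2*m) + (g x - ?f x) ^ (2*m)))"
      by (intro sum_mono power_sum3_le)
    also have "\<dots> = 9 ^ m * ((\<Sum>x\<in>Z. (?f (x + ?s) - g (x + ?s)) ^ (2*m)) + (\<Sum>x\<in>Z. (g (x + ?s) - g x) ^ (2*m)) + (\<Sum>x\<in>Z. (g x - ?f x) ^ (2*m)))"
      by (simp only: sum_distrib_left[symmetric] sum.distrib)
    also have "\<dots> \<le> 9 ^ m * (Q / 576 ^ m + Q / 576 ^ m + Q / 576 ^ m)"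
    proof (intro mult_left_mono add_mono shifted gf)
      \<comment> \<open>The uniform error becomes one relative to \<open>Q\<close> because N
        \<kappa>^(2m) \<le> Q.\<close>
      have "(\<Sum>x\<in>Z. (g (x + ?s) - g x) ^ (2*m)) \<le> (\<Sum>x\<in>Z. \<kappa> ^ (2*m) / 576 ^ m)"
        by (intro sum_mono g_pow)
      also have "\<dots> = of_int N * \<kappa> ^ (2*m) / 576 ^ m" using N_pos by simp
      also have "\<dots> \<le> Q / 576 ^ m" by (intro divide_right_mono Q) auto
      finally show "(\<Sum>x\<in>Z. (g (x + ?s) - g x) ^ (2*m)) \<le> Q / 576 ^ m" .
    qed simp
    also have "\<dots> = 3 * (Q / 64 ^ m)"
    proof -
      have "(576::real) ^ m = 9 ^ m * 64 ^ m" by (simp only: power_mult_distrib[symmetric]) simp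
      then show ?thesis by simp
    qed
    finally show "(\<Sum>x\<in>Z. (?f (x + ?s) - ?f x) ^ (2*m)) \<le> Q / 64 ^ m" by simp
  qed
qed

text \<open>Points outside G carry at most half of \<open>Q\<close>. Those with f < \<kappa>/2
  contribute at most Q/4. If f falls below half its value at some shift, f(x) is at most twice the
  difference there; 4^m shifts, a factor 4^m for the doubling and an error Q/64^m for each shift
  again leave at most Q/4. On G the bound f \<le> 1 turns mass into cardinality.\<close>

lemma large_level_set:
  fixes A B :: "int set"
  assumes m: "m \<ge> 1" and \<kappa>: "0 < \<kappa>"
  defines "Q \<equiv> (\<Sum>x\<in>Z. conv A B x ^ (2*m))"
  assumes Q: "of_int N * \<kappa> ^ (2*m) \<le> Q" and n: "real n \<le> 4 ^ m"
    and E: "\<And>j. j < n \<Longrightarrow> (\<Sum>x\<in>Z. (conv A B (x + int j * q) - conv A B x) ^ (2*m)) \<le> Q / 64 ^ m"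
  shows "of_int N * \<kappa> ^ (2*m) \<le>
    2 * real (card {x\<in>Z. \<kappa> / 2 \<le> conv A B x \<and> (\<forall>j<n. conv A B x / 2 \<le> conv A B (x + int j * q))})"
proof -
  let ?f = "conv A B"
  define G where "G = {x\<in>Z. \<kappa> / 2 \<le> ?f x \<and> (\<forall>j<n. ?f x / 2 \<le> ?f (x + int j * q))}"
  have Np: "(of_int N :: real) > 0" using N_pos by simp
  have Qpos: "Q > 0" using Q \<kappa> Np by (smt (verit) mult_pos_pos zero_less_power)
  have four: "(4::real) ^ m \<ge> 4" using power_increasing[of 1 m "4::real"] m by simp
  have pw: "?f x ^ (2*m) \<le> \<kappa> ^ (2*m) / 4 ^ m + 4 ^ m * (\<Sum>j<n. (?f (x + int j * q) - ?f x) ^ (2*m)) + of_bool (x \<in> G)"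
    (is "_ \<le> ?a + ?b + ?c") if x: "x \<in> Z" for x
  proof -
    have nn: "0 \<le> ?a" "0 \<le> ?b" "0 \<le> ?c" using \<kappa> by (auto intro!: mult_nonneg_nonneg sum_nonneg simp: power_mult)
    have two: "(2::real) ^ (2*m) = 4 ^ m" by (simp add: power_mult)
    consider "x \<in> G" | "?f x < \<kappa> / 2" | j where "j < n" "?f (x + int j * q) < ?f x / 2"
      using x by (force simp: G_def)
    then show ?thesis
    proof cases
      case 1
      have "?f x ^ (2*m) \<le> 1" by (rule power_le_one[OF conv_nonneg conv_le_1])
      moreover have "?c = 1" using 1 by (simp only: of_bool_eq)
      ultimately show ?thesis using nn(1,2) by linarith
    next
      case 2
      have "?f x ^ (2*m) \<le> (\<kappa> / 2) ^ (2*m)" using 2 by (intro power_mono conv_nonneg) auto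
      also have "\<dots> = ?a" using two by (simp only: power_divide)
      finally show ?thesis using nn by linarith
    next
      case 3
      have "?f x ^ (2*m) \<le> (2 * (?f x - ?f (x + int j * q))) ^ (2*m)"
        using 3 by (intro power_mono conv_nonneg) auto
      also have "\<dots> = 4 ^ m * (?f (x + int j * q) - ?f x) ^ (2*m)"
        using two by (simp only: power_mult_distrib) (simp only: power_mult power2_commute)
      also have "\<dots> \<le> ?b"
        using 3 by (intro mult_left_mono member_le_sum) (auto simp: power_mult)
      finally show ?thesis using nn by linarith
    qed
  qed
  have "Q \<le> (\<Sum>x\<in>Z. \<kappa> ^ (2*m) / 4 ^ m + 4 ^ m * (\<Sum>j<n. (?f (x + int j * q) - ?f x) ^ (2*m)) + of_bool (x \<in> G))"
    unfolding Q_def by (intro sum_mono pw)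
  also have "\<dots> = of_int N * \<kappa> ^ (2*m) / 4 ^ m
      + 4 ^ m * (\<Sum>j<n. \<Sum>x\<in>Z. (?f (x + int j * q) - ?f x) ^ (2*m)) + (\<Sum>x\<in>Z. of_bool (x \<in> G))"
    using N_pos by (simp add: sum.distrib sum_distrib_left[symmetric] sum.swap[of _ "{..<n}" Z])
  also have "(\<Sum>x\<in>Z. of_bool (x \<in> G)) = real (card G)"
  proof -
    have "Z \<inter> G = G" by (auto simp: G_def)
    then show ?thesis by (simp add: of_bool_def sum.If_cases)
  qed
  also have "of_int N * \<kappa> ^ (2*m) / 4 ^ m \<le> Q / 4"
    using Q Qpos four by (intro frac_le) auto
  also have "4 ^ m * (\<Sum>j<n. \<Sum>x\<in>Z. (?f (x + int j * q) - ?f x) ^ (2*m)) \<le> Q / 4"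
  proof -
    have "4 ^ m * (\<Sum>j<n. \<Sum>x\<in>Z. (?f (x + int j * q) - ?f x) ^ (2*m)) \<le> 4 ^ m * (\<Sum>j<n. Q / 64 ^ m)"
      by (intro mult_left_mono sum_mono E) auto
    also have "\<dots> = 4 ^ m * (real n * (Q / 64 ^ m))" by simp
    also have "\<dots> \<le> 4 ^ m * (4 ^ m * (Q / 64 ^ m))"
      using Qpos by (intro mult_left_mono mult_right_mono n) auto
    also have "\<dots> = Q / 4 ^ m"
    proof -
      have "(64::real) ^ m = 4 ^ m * 4 ^ m * 4 ^ m" by (simp only: power_mult_distrib[symmetric]) simp
      then show ?thesis by simp
    qed
    also have "\<dots> \<le> Q / 4" using Qpos four by (intro divide_left_mono) auto
    finally show ?thesis .
  qed
  finally have "Q \<le> 2 * real (card G)" by simp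
  then show ?thesis using Q unfolding G_def by linarith
qed

end

section \<open>Numerical choice of the parameters\<close>

lemma power_le_exp_mult: "1 \<le> x \<Longrightarrow> x \<le> exp (y::real) \<Longrightarrow> x ^ n \<le> exp (real n * y)"
  by (metis exp_of_nat_mult power_mono le_numeral_extra(1) order_trans zero_le_one)

lemma real_nat_ceiling_le: "0 \<le> x \<Longrightarrow> real (nat \<lceil>x\<rceil>) \<le> x + 1"
  using of_int_ceiling_le_add_one[of x] by simp

text \<open>Below \<open>l\<close> is the number of averaging steps, \<open>k\<close> the size of the samples, \<open>D\<close> a bound for the
  rank of the Bohr set and \<open>1 / K\<close> the quality of the Diophantine approximation.\<close>

lemma choice_of_parameters:
  fixes L \<alpha> W N :: real
  assumes L: "L \<ge> ln 2" and \<alpha>: "0 < \<alpha>" "\<alpha> \<le> 1" "1 / \<alpha> \<le> exp L" and W: "1 \<le> W" "W \<le> exp L"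
    and m: "m \<ge> 1" "L \<le> real m" and N: "N > 0" "3 * 10 ^ 12 * L ^ 3 * (real m)\<^sup>2 \<le> sqrt \<alpha> * ln N"
  obtains l k D K :: nat where "l \<ge> 1" "K \<ge> 1"
    "490000 * (real l)\<^sup>2 * real m \<le> sqrt \<alpha> / 4 * real k"
    "W * (2 * (1/2) ^ l) \<le> sqrt \<alpha> / 4 / 48"
    "16 * ln (2 * W ^ k) \<le> real D"
    "W * (real D * (7 * 4 ^ m / real K)) \<le> sqrt \<alpha> / 4 / 48"
    "4 ^ m * real K ^ D \<le> N"
proof -
  define a where "a = sqrt \<alpha>"
  have a: "0 < a" "a \<le> 1" using \<alpha> by (auto simp: a_def)
  have ln2: "ln (2::real) \<ge> 2/3" by (rule ln2_ge_two_thirds)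
  have Lhalf: "L \<ge> 1/2" using L ln2 by linarith
  have Lpos: "L > 0" using Lhalf by linarith
  have two_L: "2 \<le> exp L" using L by (metis exp_le_cancel_iff exp_ln zero_less_numeral)
  have e1: "2 \<le> exp (1::real)" using exp_ge_add_one_self[of 1] by simp
  have four_m: "(4::real) ^ m \<le> exp (2 * real m)"
  proof -
    have "(4::real) = 2\<^sup>2" by simp
    also have "\<dots> \<le> exp 1 ^ 2" using e1 by (intro power_mono) auto
    also have "\<dots> = exp 2" by (simp add: exp_of_nat_mult[symmetric])
    finally have "(4::real) ^ m \<le> exp (real m * 2)" by (intro power_le_exp_mult) auto
    then show ?thesis by (simp add: mult.commute)
  qed
  have inva: "1 / a \<le> exp L"
  proof -
    have "1 / a \<le> 1 / \<alpha>"
    proof (rule divide_left_mono)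
      show "\<alpha> \<le> a" using \<alpha> a by (metis a_def mult_left_le_one_le real_sqrt_ge_0_iff real_sqrt_mult_self abs_of_pos less_imp_le)
    qed (use a \<alpha> in auto)
    then show ?thesis using \<alpha> by linarith
  qed
  have rm: "real m \<ge> 1" using m by simp
  \<comment> \<open>W and 1 / a are at most exp L and 384 \<le> exp (9 L), so 2^l has to beat exp
    (11 L); this holds as ln 2 \<ge> 2/3 and 20 * 2/3 > 11.\<close>
  define l where "l = nat \<lceil>20 * L\<rceil>"
  have l: "20 * L \<le> real l" "real l \<le> 22 * L" using Lhalf real_nat_ceiling_ge[of "20 * L"] real_nat_ceiling_le[of "20 * L"] unfolding l_def by linarith+
  have l1: "l \<ge> 1" using l Lhalf by (cases l) auto
  define k where "k = nat \<lceil>4 * 490000 * (real l)\<^sup>2 * real m / a\<rceil>"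
  have k: "4 * 490000 * (real l)\<^sup>2 * real m / a \<le> real k" unfolding k_def by (rule real_nat_ceiling_ge)
  have l2: "(real l)\<^sup>2 \<le> 484 * L\<^sup>2"
    using power_mono[OF l(2), of 2] by (simp add: power_mult_distrib)
  have quarter: "1 / 4 \<le> L\<^sup>2 * real m / a"
  proof -
    have "1/4 \<le> L\<^sup>2" using power_mono[OF Lhalf, of 2] by (simp add: power2_eq_square)
    then have "1/4 * 1 \<le> L\<^sup>2 * real m" using rm by (intro mult_mono) auto
    also have "\<dots> \<le> L\<^sup>2 * real m / a" using a by (simp add: le_divide_eq mult_left_le)
    finally show ?thesis by simp
  qed
  have k_le: "real k \<le> 1000000000 * (L\<^sup>2 * real m / a)"
  proof -
    have up: "real k \<le> 4 * 490000 * (real l)\<^sup>2 * real m / a + 1"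
      using a unfolding k_def by (intro real_nat_ceiling_le) auto
    have "4 * 490000 * (real l)\<^sup>2 * real m / a \<le> 4 * 490000 * (484 * L\<^sup>2) * real m / a"
      using a l2 by (intro divide_right_mono mult_right_mono mult_left_mono) auto
    also have "\<dots> = 948640000 * (L\<^sup>2 * real m / a)" by simp
    finally show ?thesis using up quarter by linarith
  qed
  have k1: "real k \<ge> 1"
  proof -
    have "0 < 4 * 490000 * (real l)\<^sup>2 * real m / a" using l1 m a by simp
    then have "0 < real k" using k by linarith
    then show ?thesis by simp
  qed
  define D where "D = nat \<lceil>16 * ln (2 * W ^ k)\<rceil>"
  have D: "16 * ln (2 * W ^ k) \<le> real D" unfolding D_def by (rule real_nat_ceiling_ge)
  have W0: "W > 0" using W by simp
  have lnW: "0 \<le> ln W" "ln W \<le> L" using W W0 ln_ge_zero ln_mono[of W "exp L"] by auto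
  have lnWk: "ln (2 * W ^ k) = ln 2 + real k * ln W" using W0 by (simp add: ln_mult ln_realpow)
  have "0 \<le> real k * ln W" using lnW by simp
  then have lnWk_pos: "0 < ln (2 * W ^ k)" using lnWk ln2 by linarith
  have D1: "real D \<ge> 1"
  proof -
    have "0 < real D" using D lnWk_pos by linarith
    then show ?thesis by simp
  qed
  have D_le: "real D \<le> 40000000000 * (L ^ 3 * real m / a)"
  proof -
    have "0 \<le> 16 * ln (2 * W ^ k)" using lnWk_pos by simp
    then have up: "real D \<le> 16 * ln (2 * W ^ k) + 1" unfolding D_def by (rule real_nat_ceiling_le)
    have "ln (2 * W ^ k) \<le> L + real k * L" using lnWk lnW L by (simp add: add_mono mult_left_mono)
    moreover have "1 * L \<le> real k * L" using k1 Lpos by (intro mult_right_mono) auto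
    ultimately have "real D \<le> 34 * (real k * L)" using up Lhalf by linarith
    also have "\<dots> \<le> 34 * ((1000000000 * (L\<^sup>2 * real m / a)) * L)"
      using k_le Lpos by (intro mult_left_mono mult_right_mono) auto
    also have "\<dots> = 34000000000 * (L ^ 3 * real m / a)" by (simp add: power2_eq_square power3_eq_cube)
    also have "\<dots> \<le> 40000000000 * (L ^ 3 * real m / a)"
      using Lpos a by (intro mult_right_mono) auto
    finally show ?thesis by simp
  qed
  define Y where "Y = real D * 4 ^ m * W / a"
  have big: "1 \<le> Y"
  proof -
    have "1 * 1 * 1 \<le> real D * 4 ^ m * W" using D1 W by (intro mult_mono) auto
    also have "\<dots> \<le> real D * 4 ^ m * W / a" using a D1 W by (simp add: le_divide_eq mult_left_le)
    finally show ?thesis by (simp add: Y_def)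
  qed
  \<comment> \<open>The required inequality solved for K, with 1344 = 7 * 4 * 48.\<close>
  define K where "K = nat \<lceil>1344 * Y\<rceil>"
  have K: "1344 * Y \<le> real K" unfolding K_def by (rule real_nat_ceiling_ge)
  have K0: "real K > 0" using K big by linarith
  \<comment> \<open>Every factor is exp (O(m)) because L \<le> m. The exponents 47 + 3 + 1 + 1 + 2 +
    1 + 1 add up to 56.\<close>
  have K_le: "real K \<le> exp (56 * real m)"
  proof -
    have "real K \<le> 1344 * Y + 1" using big unfolding K_def by (intro real_nat_ceiling_le) auto
    also have "\<dots> \<le> 2048 * Y" using big by linarith
    also have "\<dots> = 2048 * real D * 4 ^ m * W * (1 / a)" by (simp add: Y_def)
    also have "\<dots> \<le> 2048 * (40000000000 * (L ^ 3 * real m / a)) * 4 ^ m * W * (1 / a)"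
      using D_le W0 a by (intro mult_right_mono mult_left_mono) auto
    also have "\<dots> = (2048 * (40000000000)) * L ^ 3 * real m * (1 / a) * 4 ^ m * W * (1 / a)" by simp
    also have "\<dots> \<le> exp (47 * real m) * exp (3 * real m) * exp (real m) * exp (real m) * exp (2 * real m) * exp (real m) * exp (real m)"
    proof (intro mult_mono)
      have "(2048 * (40000000000) :: real) \<le> 2 ^ 47" by simp
      also have "\<dots> \<le> exp 1 ^ 47" using e1 by (intro power_mono) auto
      also have "\<dots> = exp (47::real)" by (simp add: exp_of_nat_mult[symmetric])
      also have "\<dots> \<le> exp (47 * real m)" using rm by simp
      finally show "(2048 * (40000000000) :: real) \<le> exp (47 * real m)" .
      have "L \<le> exp (real m)" using m(2) exp_ge_add_one_self[of "real m"] by linarith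
      then have "L ^ 3 \<le> exp (real m) ^ 3" using Lpos by (intro power_mono) auto
      then show "L ^ 3 \<le> exp (3 * real m)" by (simp add: exp_of_nat_mult[symmetric])
      show "real m \<le> exp (real m)" using exp_ge_add_one_self[of "real m"] by linarith
      have "exp L \<le> exp (real m)" using m by simp
      then show "1 / a \<le> exp (real m)" "W \<le> exp (real m)" "1 / a \<le> exp (real m)"
        using inva W by linarith+
      show "4 ^ m \<le> exp (2 * real m)" by (rule four_m)
    qed (use Lpos a W0 in auto)
    also have "\<dots> = exp (56 * real m)" by (simp add: exp_add[symmetric])
    finally show ?thesis .
  qed
  show thesis
  proof
    show "l \<ge> 1" by (rule l1)
    show "K \<ge> 1" using K0 by simp
    show "490000 * (real l)\<^sup>2 * real m \<le> sqrt \<alpha> / 4 * real k"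
      using k a by (simp add: a_def[symmetric] divide_le_eq) (simp add: mult.commute)
    show "16 * ln (2 * W ^ k) \<le> real D" by (rule D)
    have "1344 * real D * 4 ^ m * W \<le> real K * a" using K a by (simp add: Y_def divide_le_eq)
    then show "W * (real D * (7 * 4 ^ m / real K)) \<le> sqrt \<alpha> / 4 / 48"
      using K0 by (simp add: a_def[symmetric] divide_le_eq) (simp add: mult_ac)
    have "4 ^ m * real K ^ D \<le> exp (2 * real m) * exp (real D * (56 * real m))"
      using K0 by (intro mult_mono power_le_exp_mult K_le four_m) auto
    also have "\<dots> = exp (2 * real m + real D * (56 * real m))" by (simp add: exp_add)
    also have "\<dots> \<le> exp (ln N)"
    proof (subst exp_le_cancel_iff)
      have "1 * real m \<le> real D * real m" using D1 by (intro mult_right_mono) auto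
      then have "2 * real m + real D * (56 * real m) \<le> 58 * real m * real D" by simp
      also have "\<dots> \<le> 58 * real m * (40000000000 * (L ^ 3 * real m / a))"
        using D_le by (intro mult_left_mono) auto
      \<comment> \<open>58 * 4 * 10^10, rounded up, is the constant 3 * 10^12 in the hypothesis on
        N.\<close>
      also have "\<dots> = (2320000000000) * (L ^ 3 * (real m)\<^sup>2) / a" by (simp add: power2_eq_square)
      also have "\<dots> \<le> 3 * 10 ^ 12 * (L ^ 3 * (real m)\<^sup>2) / a"
        using Lpos a by (intro divide_right_mono mult_right_mono) auto
      also have "\<dots> \<le> ln N" using N(2) a by (simp add: a_def[symmetric] divide_le_eq) (simp add: mult_ac)
      finally show "2 * real m + real D * (56 * real m) \<le> ln N" .
    qed
    also have "\<dots> = N" using N by simp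
    finally show "4 ^ m * real K ^ D \<le> N" .
    have "W * 384 / a \<le> 2 ^ l"
    proof -
      have "W * 384 / a = W * 384 * (1 / a)" by simp
      also have "\<dots> \<le> exp L * exp L ^ 9 * exp L"
      proof (intro mult_mono)
        have "(384::real) \<le> 2 ^ 9" by simp
        also have "\<dots> \<le> exp L ^ 9" using two_L by (intro power_mono) auto
        finally show "384 \<le> exp L ^ 9" .
      qed (use W inva a in auto)
      also have "\<dots> = exp (11 * L)" by (simp add: exp_of_nat_mult[symmetric] exp_add[symmetric])
      also have "\<dots> \<le> exp (real l * ln 2)"
      proof (subst exp_le_cancel_iff)
        have "11 * L \<le> 20 * L * (2/3)" using Lpos by simp
        also have "\<dots> \<le> real l * ln 2" using l ln2 Lpos by (intro mult_mono) auto
        finally show "11 * L \<le> real l * ln 2" .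
      qed
      also have "\<dots> = 2 ^ l" by (simp add: exp_of_nat_mult)
      finally show ?thesis .
    qed
    then show "W * (2 * (1/2) ^ l) \<le> sqrt \<alpha> / 4 / 48"
      using a by (simp add: a_def[symmetric] power_divide divide_le_eq) (simp add: mult_ac)
  qed
qed

context cyclic
begin

text \<open>Here \<alpha> is a parameter not tied to A: it stays the density of the original first
  set also when popular sums take the place of A. The height sqrt \<alpha> / 4 is one that both
  cases of the dichotomy can reach.\<close>

lemma progression_with_large_level_set:
  fixes L \<alpha> :: real
  assumes A: "A \<subseteq> Z" and B: "B \<subseteq> Z" "B \<noteq> {}"
    and L: "L \<ge> ln 2" and \<alpha>: "0 < \<alpha>" "\<alpha> \<le> 1" "1 / \<alpha> \<le> exp L" and W: "of_int N / card B \<le> exp L"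
    and m: "m \<ge> 1" "L \<le> real m" and N: "3 * 10 ^ 12 * L ^ 3 * (real m)\<^sup>2 \<le> sqrt \<alpha> * ln (of_int N)"
    and Q: "of_int N * (sqrt \<alpha> / 4) ^ (2*m) \<le> (\<Sum>x\<in>Z. conv A B x ^ (2*m))"
  obtains q where "0 < q" "4 ^ m * q \<le> N"
    "of_int N * (sqrt \<alpha> / 4) ^ (2*m) \<le> 2 * real (card {x\<in>Z. sqrt \<alpha> / 4 / 2 \<le> conv A B x \<and>
       (\<forall>j<4 ^ m. conv A B x / 2 \<le> conv A B (x + int j * q))})"
proof -
  have "finite B" using B finite_subset by blast
  then have cB: "real (card B) > 0" using B by (simp add: card_gt_0_iff)
  have "real (card B) \<le> of_int N" using card_mono[of Z B] B N_pos by simp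
  then have W1: "1 \<le> of_int N / card B" using cB by simp
  have Np: "(of_int N :: real) > 0" using N_pos by simp
  obtain l k D K :: nat where p: "l \<ge> 1" "K \<ge> 1"
    "490000 * (real l)\<^sup>2 * real m \<le> sqrt \<alpha> / 4 * real k"
    "of_int N / card B * (2 * (1/2) ^ l) \<le> sqrt \<alpha> / 4 / 48"
    "16 * ln (2 * (of_int N / card B) ^ k) \<le> real D"
    "of_int N / card B * (real D * (7 * 4 ^ m / real K)) \<le> sqrt \<alpha> / 4 / 48"
    "4 ^ m * real K ^ D \<le> of_int N"
    by (rule choice_of_parameters[OF L \<alpha> W1 W m Np N])
  have \<kappa>: "0 < sqrt \<alpha> / 4" using \<alpha> by simp
  obtain q where q: "0 < q" "int (4 ^ m) * q \<le> N"
    "\<And>j. j < 4 ^ m \<Longrightarrow> (\<Sum>x\<in>Z. (conv A B (x + int j * q) - conv A B x) ^ (2*m))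
        \<le> (\<Sum>x\<in>Z. conv A B x ^ (2*m)) / 64 ^ m"
    using long_progression_of_almost_periods[OF A B m(1) \<kappa> Q p(1-5), of "4 ^ m"] p(6,7) by auto
  show thesis
  proof
    show "0 < q" "4 ^ m * q \<le> N" using q by simp_all
    show "of_int N * (sqrt \<alpha> / 4) ^ (2*m) \<le> 2 * real (card {x\<in>Z. sqrt \<alpha> / 4 / 2 \<le> conv A B x \<and>
       (\<forall>j<4 ^ m. conv A B x / 2 \<le> conv A B (x + int j * q))})"
      by (rule large_level_set[OF m(1) \<kappa> Q _ q(3)]) auto
  qed
qed

text \<open>If the popular sums \<open>D\<close> of \<open>A + B\<close> have density at least \<open>sqrt \<alpha>\<close>, the level set argument
  applies to \<open>conv D C\<close>.  Otherwise Hoelder forces \<open>conv A B\<close> to be at least about \<open>sqrt \<alpha>\<close> in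
  \<open>L\<^sup>2\<^sup>m\<close>, so the argument applies to \<open>conv A B\<close> itself, and averaging over \<open>C\<close> recovers the
  missing factor in the number of representations.\<close>

lemma progression_with_many_representations:
  fixes A B C :: "int set"
  assumes A: "A \<subseteq> Z" "A \<noteq> {}" and B: "B \<subseteq> Z" "B \<noteq> {}" and C: "C \<subseteq> Z" "C \<noteq> {}"
  defines "\<alpha> \<equiv> real (card A) / of_int N" and "\<beta> \<equiv> real (card B) / of_int N"
    and "\<gamma> \<equiv> real (card C) / of_int N"
  defines "L \<equiv> ln (2 / (\<alpha> * \<beta> * \<gamma>))"
  assumes m: "m \<ge> 1" "L \<le> real m"
    and N: "3 * 10 ^ 12 * L ^ 3 * (real m)\<^sup>2 \<le> sqrt \<alpha> * ln (of_int N)"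
  obtains x q where "0 < q" "4 ^ m * q \<le> N"
    "\<And>j. j < 4 ^ m \<Longrightarrow>
       (of_int N)\<^sup>2 * exp (- 20 * L * real m) \<le> (\<Sum>c\<in>C. real (card B) * conv A B (x + int j * q - c))"
proof -
  have fin: "finite A" "finite B" "finite C" using A B C finite_subset by blast+
  have Np: "(of_int N :: real) > 0" using N_pos by simp
  have cards: "real (card A) > 0" "real (card B) > 0" "real (card C) > 0"
    using fin A B C by (auto simp: card_gt_0_iff)
  have card_le: "real (card S) \<le> of_int N" if "S \<subseteq> Z" for S using card_mono[of Z S] that N_pos by simp
  have pos: "0 < \<alpha>" "0 < \<beta>" "0 < \<gamma>" using cards Np by (auto simp: \<alpha>_def \<beta>_def \<gamma>_def)
  have le1: "\<alpha> \<le> 1" "\<beta> \<le> 1" "\<gamma> \<le> 1"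
    using card_le A B C Np by (auto simp: \<alpha>_def \<beta>_def \<gamma>_def)
  have prod_eq: "\<alpha> * \<beta> * \<gamma> = 2 * exp (- L)" using pos by (simp add: L_def exp_minus)
  have prod_le: "\<alpha> * \<beta> * \<gamma> \<le> \<alpha>" "\<alpha> * \<beta> * \<gamma> \<le> \<beta>" "\<alpha> * \<beta> * \<gamma> \<le> \<gamma>" "\<alpha> * \<beta> * \<gamma> \<le> \<beta> * \<gamma>" "\<alpha> * \<beta> * \<gamma> \<le> 1"
  proof -
    have "\<beta> * \<gamma> \<le> 1" "\<alpha> * \<gamma> \<le> 1" "\<alpha> * \<beta> \<le> 1" using pos le1 by (simp_all add: mult_le_one)
    then show a: "\<alpha> * \<beta> * \<gamma> \<le> \<alpha>" and "\<alpha> * \<beta> * \<gamma> \<le> \<beta>" "\<alpha> * \<beta> * \<gamma> \<le> \<gamma>" "\<alpha> * \<beta> * \<gamma> \<le> \<beta> * \<gamma>"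
      using pos le1 mult_left_mono[of "\<beta> * \<gamma>" 1 \<alpha>] mult_left_mono[of "\<alpha> * \<gamma>" 1 \<beta>]
        mult_right_mono[of "\<alpha> * \<beta>" 1 \<gamma>] mult_right_mono[of \<alpha> 1 "\<beta> * \<gamma>"] by (simp_all add: mult_ac)
    then show "\<alpha> * \<beta> * \<gamma> \<le> 1" using le1 by linarith
  qed
  have L2: "ln 2 \<le> L"
    unfolding L_def using prod_le(5) pos by (intro ln_mono) (auto simp: le_divide_eq)
  have Lhalf: "1/2 \<le> L" using L2 ln2_ge_two_thirds by linarith
  have inv: "1 / x \<le> exp L" if "\<alpha> * \<beta> * \<gamma> \<le> x" "0 < x" for x
  proof -
    have "exp (- L) \<le> x" using prod_eq that(1) by (smt (verit) exp_gt_zero)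
    then show ?thesis using that(2) by (simp add: exp_minus divide_le_eq field_simps)
  qed
  have inva: "1 / \<alpha> \<le> exp L" using inv prod_le pos by blast
  have WB: "of_int N / card B \<le> exp L" using inv[of \<beta>] prod_le pos by (simp add: \<beta>_def)
  have WC: "of_int N / card C \<le> exp L" using inv[of \<gamma>] prod_le pos by (simp add: \<gamma>_def)
  define a where "a = sqrt \<alpha>"
  have a: "0 < a" "a \<le> 1" "a * a = \<alpha>" using pos le1 by (auto simp: a_def)
  have rm: "real m \<ge> 1" using m by simp
  have Lm: "L \<le> L * real m" using rm Lhalf by simp
  have e1: "2 \<le> exp (1::real)" using exp_ge_add_one_self[of 1] by simp
  have two_pow: "exp (- (real n)) \<le> 1 / 2 ^ n" for n
  proof -
    have "(2::real) ^ n \<le> exp 1 ^ n" using e1 by (intro power_mono) auto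
    also have "\<dots> = exp (real n)" by (simp add: exp_of_nat_mult[symmetric])
    finally show ?thesis by (simp add: exp_minus field_simps)
  qed
  have a_ge: "exp (- L / 2) \<le> a"
  proof -
    have "exp (- L / 2) ^ 2 = exp (- L)" by (simp add: exp_of_nat_mult[symmetric])
    also have "\<dots> \<le> a ^ 2" using prod_eq prod_le(1) a by (simp add: power2_eq_square) (smt (verit) exp_gt_zero)
    finally show ?thesis using a by (simp add: power2_le_iff_abs_le)
  qed
  let ?f = "conv A B"
  let ?R = "\<lambda>y. \<Sum>c\<in>C. real (card B) * ?f (y - c)"
  \<comment> \<open>The threshold is half the mean \<alpha> of f over \<open>Z\<close>, so that D
    carries at least half of its mass.\<close>
  define D where "D = {y \<in> Z. \<alpha> / 2 \<le> ?f y}"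
  have D: "D \<subseteq> Z" "finite D" by (auto simp: D_def intro: finite_subset[of _ Z])
  have f_nonneg: "0 \<le> ?f y" for y by (rule conv_nonneg)
  show thesis
  proof (cases "a * of_int N \<le> real (card D)")
    case True
    \<comment> \<open>A power mean is enough here, since \<open>conv D C\<close> has mean card D / N
      \<ge> a. The weaker a / 4 matches the other case.\<close>
    have "(a / 4) ^ (2*m) \<le> (\<Sum>x\<in>Z. conv D C x ^ (2*m)) / card Z"
    proof -
      have "a / 4 \<le> a" using a by simp
      also have "a \<le> (\<Sum>x\<in>Z. conv D C x) / card Z"
        using True sum_conv[OF D(1) fin(3) C(2)] Np by (simp add: le_divide_eq)
      finally have "(a / 4) ^ (2*m) \<le> ((\<Sum>x\<in>Z. conv D C x) / card Z) ^ (2*m)"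
        using a by (intro power_mono) auto
      also have "\<dots> \<le> (\<Sum>x\<in>Z. conv D C x ^ (2*m)) / card Z"
        using N_pos by (intro power_avg_le_avg_power) auto
      finally show ?thesis .
    qed
    then have Q: "of_int N * (sqrt \<alpha> / 4) ^ (2*m) \<le> (\<Sum>x\<in>Z. conv D C x ^ (2*m))"
      using Np by (simp add: a_def le_divide_eq mult.commute)
    obtain q where q: "0 < q" "4 ^ m * q \<le> N"
      "of_int N * (sqrt \<alpha> / 4) ^ (2*m) \<le> 2 * real (card {x\<in>Z. sqrt \<alpha> / 4 / 2 \<le> conv D C x \<and>
       (\<forall>j<4 ^ m. conv D C x / 2 \<le> conv D C (x + int j * q))})"
      using progression_with_large_level_set[OF D(1) C L2 pos(1) le1(1) inva WC m N Q] by blast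
    define G where "G = {x\<in>Z. sqrt \<alpha> / 4 / 2 \<le> conv D C x \<and>
       (\<forall>j<4 ^ m. conv D C x / 2 \<le> conv D C (x + int j * q))}"
    have "0 < of_int N * (sqrt \<alpha> / 4) ^ (2*m)" using Np pos by simp
    also note q(3)[folded G_def]
    finally have "G \<noteq> {}" by auto
    then obtain x where x: "a / 8 \<le> conv D C x" "\<And>j. j < 4 ^ m \<Longrightarrow> conv D C x / 2 \<le> conv D C (x + int j * q)"
      by (auto simp: G_def a_def)
    show thesis
    proof (rule that[OF q(1,2)])
      fix j :: nat assume j: "j < 4 ^ m"
      let ?y = "x + int j * q"
      \<comment> \<open>A proportion a / 16 of the c in C brings the point into D, and each such c
        contributes at least |B| \<alpha> / 2. In this case only exp (O(L)) is lost.\<close>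
      have "a / 16 \<le> conv D C ?y" using x(1) x(2)[OF j] by simp
      then have "a / 16 * card C \<le> (\<Sum>c\<in>C. ind D (?y - c))" using cards by (simp add: conv_def le_divide_eq)
      then have "card B * (\<alpha> / 2) * (a / 16 * card C) \<le> card B * (\<alpha> / 2) * (\<Sum>c\<in>C. ind D (?y - c))"
        using pos by (intro mult_left_mono) auto
      also have "\<dots> = (\<Sum>c\<in>C. card B * (\<alpha> / 2 * ind D (?y - c)))" by (simp add: sum_distrib_left mult.assoc)
      also have "\<dots> \<le> ?R ?y"
      proof (intro sum_mono mult_left_mono)
        fix c
        show "\<alpha> / 2 * ind D (?y - c) \<le> ?f (?y - c)"
          using f_nonneg[of "?y - c"] conv_mod[of A B "?y - c"] by (auto simp: ind_def D_def)
      qed auto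
      also have "card B * (\<alpha> / 2) * (a / 16 * card C) = (of_int N)\<^sup>2 * ((\<alpha> * \<beta> * \<gamma>) * a / 32)"
        using Np by (simp add: \<beta>_def \<gamma>_def power2_eq_square)
      finally have R: "(of_int N)\<^sup>2 * ((\<alpha> * \<beta> * \<gamma>) * a / 32) \<le> ?R ?y" .
      have "- 20 * L * real m \<le> - L + (- L / 2) + (- 4)" using Lm Lhalf by linarith
      then have "exp (- 20 * L * real m) \<le> exp (- L + (- L / 2) + (- 4))" by (simp only: exp_le_cancel_iff)
      also have "\<dots> = exp (- L) * exp (- L / 2) * exp (- 4)" by (simp only: exp_add)
      also have "\<dots> \<le> exp (- L) * a * (1 / 16)"
        using a a_ge two_pow[of 4] by (intro mult_mono) auto
      also have "\<dots> = (\<alpha> * \<beta> * \<gamma>) * a / 32" by (simp add: prod_eq)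
      finally have "(of_int N)\<^sup>2 * exp (- 20 * L * real m) \<le> (of_int N)\<^sup>2 * ((\<alpha> * \<beta> * \<gamma>) * a / 32)"
        by (intro mult_left_mono) auto
      with R show "(of_int N)\<^sup>2 * exp (- 20 * L * real m) \<le> ?R ?y" by linarith
    qed
  next
    case False
    have sum_D: "\<alpha> * of_int N / 2 \<le> (\<Sum>x\<in>D. ?f x)"
    proof -
      have "\<alpha> * of_int N = (\<Sum>x\<in>Z. ?f x)" using sum_conv[OF A(1) fin(2) B(2)] Np by (simp add: \<alpha>_def)
      also have "\<dots> = (\<Sum>x\<in>D. ?f x) + (\<Sum>x\<in>Z - D. ?f x)" using D by (simp add: sum.subset_diff)
      also have "(\<Sum>x\<in>Z - D. ?f x) \<le> (\<Sum>x\<in>Z - D. \<alpha> / 2)" by (rule sum_mono) (auto simp: D_def)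
      also have "\<dots> \<le> (\<Sum>x\<in>Z. \<alpha> / 2)" using pos by (intro sum_mono2) auto
      also have "\<dots> = \<alpha> * of_int N / 2" using Np by simp
      finally show ?thesis by simp
    qed
    have "0 < \<alpha> * of_int N / 2" using pos Np by simp
    then have Dne: "D \<noteq> {}" using sum_D by auto
    define d where "d = real (card D)"
    have d: "0 < d" "d < a * of_int N" using Dne D(2) False by (auto simp: d_def card_gt_0_iff)
    \<comment> \<open>D has fewer than a N elements but mass at least \<alpha> N / 2, so f averages
      more than a / 2 on it. Writing d r^(2m) as (\<alpha> N / 2) r^(2m-1) bounds the sum from below
      by a N (a / 2)^(2m). The lost factor a is paid by passing from a / 2 to a / 4, as 4^(-m) \<le>
      a follows from L \<le> m.\<close>
    have Q: "of_int N * (sqrt \<alpha> / 4) ^ (2*m) \<le> (\<Sum>x\<in>Z. ?f x ^ (2*m))"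
    proof -
      define r where "r = \<alpha> * of_int N / (2 * d)"
      have "a * d \<le> a * (a * of_int N)" using a d by (intro mult_left_mono) auto
      then have r: "a / 2 \<le> r" using d by (simp add: r_def a(3)[symmetric] le_divide_eq mult.assoc)
      obtain m' where m': "2 * m = Suc m'" using m by (cases "2*m") auto
      have "of_int N * (a / 4) ^ (2*m) = of_int N * (1/4) ^ m * (a / 2) ^ (2*m)"
      proof -
        have "(a / 4) ^ (2*m) = (1/2) ^ (2*m) * (a / 2) ^ (2*m)" by (simp only: power_mult_distrib[symmetric]) simp
        also have "(1/2::real) ^ (2*m) = (1/4) ^ m" by (simp add: power_mult power_divide)
        finally show ?thesis by simp
      qed
      also have "\<dots> \<le> of_int N * a * (a / 2) ^ (2*m)"
      proof (intro mult_right_mono mult_left_mono)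
        have "(1/4::real) ^ m \<le> exp (-1) ^ m"
        proof (intro power_mono)
          show "1/4 \<le> exp (- 1::real)" using exp_le by (simp add: exp_minus field_simps)
        qed simp
        also have "\<dots> = exp (- real m)" by (simp add: exp_of_nat_mult[symmetric])
        also have "\<dots> \<le> exp (- L / 2)" using m(2) Lhalf by simp
        also have "\<dots> \<le> a" by (rule a_ge)
        finally show "(1/4) ^ m \<le> a" .
      qed (use Np a in auto)
      also have "\<dots> = (\<alpha> * of_int N / 2) * (a / 2) ^ m'" by (simp add: m' a(3)[symmetric])
      also have "\<dots> \<le> (\<alpha> * of_int N / 2) * r ^ m'"
        using r a pos Np by (intro mult_left_mono power_mono) auto
      also have "\<dots> = d * r ^ (2*m)" using d by (simp add: m' r_def)
      also have "\<dots> \<le> d * ((\<Sum>x\<in>D. ?f x) / card D) ^ (2*m)"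
      proof (intro mult_left_mono power_mono)
        show "r \<le> (\<Sum>x\<in>D. ?f x) / card D" using sum_D d by (simp add: r_def d_def[symmetric] field_simps)
        show "0 \<le> r" using r a by linarith
      qed (use d in auto)
      also have "\<dots> \<le> d * ((\<Sum>x\<in>D. ?f x ^ (2*m)) / card D)"
        using d by (intro mult_left_mono power_avg_le_avg_power D Dne) auto
      also have "\<dots> = (\<Sum>x\<in>D. ?f x ^ (2*m))" using d by (simp add: d_def)
      also have "\<dots> \<le> (\<Sum>x\<in>Z. ?f x ^ (2*m))" using D f_nonneg by (intro sum_mono2) auto
      finally show ?thesis by (simp add: a_def)
    qed
    obtain q where q: "0 < q" "4 ^ m * q \<le> N"
      "of_int N * (sqrt \<alpha> / 4) ^ (2*m) \<le> 2 * real (card {x\<in>Z. sqrt \<alpha> / 4 / 2 \<le> ?f x \<and>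
       (\<forall>j<4 ^ m. ?f x / 2 \<le> ?f (x + int j * q))})"
      using progression_with_large_level_set[OF A(1) B L2 pos(1) le1(1) inva WB m N Q] by blast
    define G where "G = {x\<in>Z. a / 8 \<le> ?f x \<and> (\<forall>j<4 ^ m. ?f x / 2 \<le> ?f (x + int j * q))}"
    have cG: "of_int N * (a / 4) ^ (2*m) \<le> 2 * real (card G)" using q(3) by (simp add: G_def a_def)
    have G: "G \<subseteq> Z" by (auto simp: G_def)
    \<comment> \<open>The mean of \<open>conv G C\<close> is card G / N, so some y has y - c in G
      for at least that proportion of c in C. One y serves every j, since membership in G controls
      the whole progression.\<close>
    have "\<exists>y. card G / of_int N \<le> conv G C y"
    proof (rule ccontr)
      assume "\<not> ?thesis"
      then have "(\<Sum>x\<in>Z. conv G C x) < (\<Sum>x\<in>Z. card G / of_int N)"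
        using N_pos by (intro sum_strict_mono) (auto simp: not_le)
      then show False using sum_conv[OF G fin(3) C(2)] Np by simp
    qed
    then obtain y where y: "card G / of_int N \<le> conv G C y" by blast
    show thesis
    proof (rule that[OF q(1,2)])
      fix j :: nat assume j: "j < 4 ^ m"
      have "card G / of_int N * card C \<le> (\<Sum>c\<in>C. ind G (y - c))"
        using y cards by (simp add: conv_def le_divide_eq)
      then have "card B * (a / 16) * (card G / of_int N * card C) \<le> card B * (a / 16) * (\<Sum>c\<in>C. ind G (y - c))"
        using a by (intro mult_left_mono) auto
      also have "\<dots> = (\<Sum>c\<in>C. card B * (a / 16 * ind G (y - c)))" by (simp add: sum_distrib_left mult.assoc)
      also have "\<dots> \<le> ?R (y + int j * q)"
      proof (intro sum_mono mult_left_mono)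
        fix c
        have "a / 16 \<le> ?f (y + int j * q - c)" if "(y - c) mod N \<in> G"
        proof -
          have "a / 8 \<le> ?f ((y - c) mod N)" "?f ((y - c) mod N) / 2 \<le> ?f ((y - c) mod N + int j * q)"
            using that j by (auto simp: G_def)
          moreover have "?f ((y - c) mod N + int j * q) = ?f (y + int j * q - c)"
            by (metis conv_mod mod_add_left_eq diff_add_eq)
          ultimately show ?thesis by linarith
        qed
        then show "a / 16 * ind G (y - c) \<le> ?f (y + int j * q - c)"
          using f_nonneg by (auto simp: ind_def)
      qed auto
      finally have R1: "card B * (a / 16) * (card G / of_int N * card C) \<le> ?R (y + int j * q)" .
      have "card B * (a / 16) * (of_int N * (a / 4) ^ (2*m) / 2 / of_int N * card C)
          \<le> card B * (a / 16) * (card G / of_int N * card C)"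
        using cG a Np by (intro mult_left_mono mult_right_mono divide_right_mono) auto
      moreover have "card B * (a / 16) * (of_int N * (a / 4) ^ (2*m) / 2 / of_int N * card C)
         = (of_int N)\<^sup>2 * (\<beta> * \<gamma> * (a / 4) ^ Suc (2*m) / 8)"
        using Np by (simp add: \<beta>_def \<gamma>_def power2_eq_square)
      ultimately have R: "(of_int N)\<^sup>2 * (\<beta> * \<gamma> * (a / 4) ^ Suc (2*m) / 8) \<le> ?R (y + int j * q)"
        using R1 by linarith
      \<comment> \<open>Since a / 4 \<ge> exp (-5 L) and 2m + 1 \<le> 3m, the power of a / 4 costs
        at most 15 L m in the exponent; the remaining 5 L m absorbs the densities and the
        constants.\<close>
      have "- 20 * L * real m \<le> - L + (- (15 * L * real m)) + (- 2)" using Lm Lhalf by linarith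
      then have "exp (- 20 * L * real m) \<le> exp (- L + (- (15 * L * real m)) + (- 2))" by (simp only: exp_le_cancel_iff)
      also have "\<dots> = exp (- L) * exp (- (15 * L * real m)) * exp (- 2)" by (simp only: exp_add)
      also have "\<dots> \<le> exp (- L) * (a / 4) ^ Suc (2*m) * (1 / 4)"
      proof (intro mult_mono)
        have "- 5 * L \<le> - L / 2 + (- 2)" using Lhalf by linarith
        then have "exp (- 5 * L) \<le> exp (- L / 2 + (- 2))" by (simp only: exp_le_cancel_iff)
        also have "\<dots> = exp (- L / 2) * exp (- 2)" by (simp only: exp_add)
        also have "\<dots> \<le> a * (1 / 4)" using a a_ge two_pow[of 2] by (intro mult_mono) auto
        finally have base: "exp (- 5 * L) \<le> a / 4" by simp
        have "exp (- (15 * L * real m)) \<le> exp (real (Suc (2*m)) * (- 5 * L))"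
        proof -
          have "real (Suc (2*m)) * (5 * L) \<le> (3 * real m) * (5 * L)" using rm Lhalf by (intro mult_right_mono) auto
          then show ?thesis by (simp add: mult_ac)
        qed
        also have "\<dots> = exp (- 5 * L) ^ Suc (2*m)" by (rule exp_of_nat_mult)
        also have "\<dots> \<le> (a / 4) ^ Suc (2*m)" by (intro power_mono base) auto
        finally show "exp (- (15 * L * real m)) \<le> (a / 4) ^ Suc (2*m)" .
        show "exp (- 2) \<le> (1 / 4 :: real)" using two_pow[of 2] by simp
      qed (use a in auto)
      also have "\<dots> = (\<alpha> * \<beta> * \<gamma>) * (a / 4) ^ Suc (2*m) / 8" by (simp add: prod_eq)
      also have "\<dots> \<le> \<beta> * \<gamma> * (a / 4) ^ Suc (2*m) / 8"
        by (rule divide_right_mono[OF mult_right_mono[OF prod_le(4)]]) (use a in auto)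
      finally have "(of_int N)\<^sup>2 * exp (- 20 * L * real m) \<le> (of_int N)\<^sup>2 * (\<beta> * \<gamma> * (a / 4) ^ Suc (2*m) / 8)"
        by (intro mult_left_mono) auto
      with R show "(of_int N)\<^sup>2 * exp (- 20 * L * real m) \<le> ?R (y + int j * q)" by linarith
    qed
  qed
qed

end

section \<open>Passage to residues as natural numbers, and the final constants\<close>

lemma reps_eq_sum_conv:
  assumes N: "N > 0" and A: "A \<subseteq> {..<N}" and B: "B \<subseteq> {..<N}" "B \<noteq> {}" and C: "C \<subseteq> {..<N}"
  shows "real (reps N A B C (nat (y mod int N)))
    = (\<Sum>c\<in>int ` C. real (card (int ` B)) * cyclic.conv (int N) (int ` A) (int ` B) (y - c))"
proof -
  interpret cyclic "int N" using N by unfold_locales simp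
  have fin: "finite A" "finite B" "finite C" using A B C finite_subset by blast+
  have cB: "card (int ` B) \<noteq> 0" using fin B by simp
  let ?p = "\<lambda>z b. (y - int z - int b) mod int N \<in> int ` A"
  have key: "(x + b + z) mod N = nat (y mod int N) \<longleftrightarrow> int x = (y - int z - int b) mod int N"
    if "x < N" for x b z
  proof -
    have "(x + b + z) mod N = nat (y mod int N) \<longleftrightarrow> int ((x + b + z) mod N) = y mod int N"
      using N by (metis int_nat_eq nat_int pos_mod_sign of_nat_0_less_iff)
    also have "\<dots> \<longleftrightarrow> (int x + int b + int z) mod int N = y mod int N" by (simp add: zmod_int)
    also have "\<dots> \<longleftrightarrow> int x mod int N = (y - int z - int b) mod int N"
      by (simp add: mod_eq_dvd_iff algebra_simps)
    also have "int x mod int N = int x" using that by simp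
    finally show ?thesis .
  qed
  \<comment> \<open>The first coordinate of a triple is determined by the other two, so the triples
    are indexed by pairs (z, b).\<close>
  define g where "g = (\<lambda>(z, b). (nat ((y - int z - int b) mod int N), b, z))"
  define T where "T = (SIGMA z:C. {b\<in>B. ?p z b})"
  have "{(x, b, z). x \<in> A \<and> b \<in> B \<and> z \<in> C \<and> (x + b + z) mod N = nat (y mod int N)} = g ` T"
    (is "?S = _")
  proof (intro equalityI subsetI)
    fix t assume "t \<in> ?S"
    then obtain x b z where t: "t = (x, b, z)" "x \<in> A" "b \<in> B" "z \<in> C"
      and eq: "(x + b + z) mod N = nat (y mod int N)" by blast
    have "int x = (y - int z - int b) mod int N" using key[of x b z] t(2) eq A by blast
    then have "(z, b) \<in> T" "t = g (z, b)" using t by (auto simp: T_def g_def simp flip: \<open>int x = _\<close>)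
    then show "t \<in> g ` T" by blast
  next
    fix t assume "t \<in> g ` T"
    then obtain z b where zb: "z \<in> C" "b \<in> B" "?p z b" "t = g (z, b)" by (auto simp: T_def)
    then obtain x where x: "x \<in> A" "int x = (y - int z - int b) mod int N" by auto
    then have "t = (x, b, z)" using zb(4) by (simp add: g_def flip: x(2))
    moreover have "(x + b + z) mod N = nat (y mod int N)" using key[of x b z] x A by blast
    ultimately show "t \<in> ?S" using x zb by simp
  qed
  moreover have "inj_on g T" by (auto simp: inj_on_def g_def)
  ultimately have "reps N A B C (nat (y mod int N)) = card (SIGMA z:C. {b\<in>B. ?p z b})"
    unfolding reps_def by (simp add: card_image T_def)
  also have "\<dots> = (\<Sum>z\<in>C. card {b\<in>B. ?p z b})" using fin by simp
  finally have "real (reps N A B C (nat (y mod int N))) = (\<Sum>z\<in>C. real (card {b\<in>B. ?p z b}))" by simp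
  also have "\<dots> = (\<Sum>z\<in>C. real (card (int ` B)) * conv (int ` A) (int ` B) (y - int z))"
  proof (rule sum.cong)
    fix z
    have "real (card (int ` B)) * conv (int ` A) (int ` B) (y - int z) = (\<Sum>b\<in>int ` B. ind (int ` A) (y - int z - b))"
      using cB by (simp add: conv_def)
    also have "\<dots> = (\<Sum>b\<in>B. of_bool (?p z b))" by (subst sum.reindex) (auto simp: ind_def)
    also have "\<dots> = real (card {b\<in>B. ?p z b})"
      using fin by (simp add: of_bool_def sum.If_cases Int_def)
    finally show "real (card {b\<in>B. ?p z b}) = real (card (int ` B)) * conv (int ` A) (int ` B) (y - int z)" by simp
  qed simp
  finally show ?thesis by (simp add: sum.reindex)
qed

lemma sumset3_of_reps_pos: "0 < reps N A B C t \<Longrightarrow> t \<in> sumset3 N A B C"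
  unfolding reps_def sumset3_def by (force simp: card_gt_0_iff)

theorem theorem1p6:
  shows "\<exists>c::real. c > 0 \<and>
    (\<forall>(\<epsilon>::real) (N::nat) (A::nat set) (B::nat set) (C::nat set).
      0 < \<epsilon> \<and> \<epsilon> < 1 \<and> real N \<ge> 1 + exp (exp (exp 1)) \<and>
      A \<subseteq> {..<N} \<and> B \<subseteq> {..<N} \<and> C \<subseteq> {..<N} \<and>
      A \<noteq> {} \<and> B \<noteq> {} \<and> C \<noteq> {} \<and>
      (let \<alpha> = real (card A) / real N; \<beta> = real (card B) / real N;
           \<gamma> = real (card C) / real N in
        \<alpha> * (ln (2 / (\<alpha> * \<beta> * \<gamma>))) powr (-14) \<ge> (c * \<epsilon> * ln (real N)) powr (-2))
      \<longrightarrow>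
      (\<exists>a d L. a < N \<and> d < N \<and> card (ap_mod N a d L) = L \<and>
         ap_mod N a d L \<subseteq> sumset3 N A B C \<and>
         (let \<alpha> = real (card A) / real N; \<beta> = real (card B) / real N;
              \<gamma> = real (card C) / real N in
           real L \<ge> exp (c * \<alpha> powr (1/4) * (\<epsilon> * ln (real N)) powr (1/2)
                         * (ln (2 / (\<alpha> * \<beta> * \<gamma>))) powr (-7/2))) \<and>
         (\<forall>t \<in> ap_mod N a d L. real (reps N A B C t) \<ge> real N powr (2 - \<epsilon>))))"
proof (intro exI[of _ "1 / 10 ^ 15"] conjI allI impI; (elim conjE)?)
  fix \<epsilon> :: real and N :: nat and A B C :: "nat set"
  \<comment> \<open>10^15 leaves room for the \<open>size\<close> bound, where the constants
    multiply up to 192 * 10^12.\<close>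
  define c :: real where "c = 1 / 10 ^ 15"
  define \<alpha> where "\<alpha> = real (card A) / real N"
  define \<beta> where "\<beta> = real (card B) / real N"
  define \<gamma> where "\<gamma> = real (card C) / real N"
  define L where "L = ln (2 / (\<alpha> * \<beta> * \<gamma>))"
  assume \<epsilon>: "0 < \<epsilon>" "\<epsilon> < 1" and N: "real N \<ge> 1 + exp (exp (exp 1))"
    and A: "A \<subseteq> {..<N}" "A \<noteq> {}" and B: "B \<subseteq> {..<N}" "B \<noteq> {}" and C: "C \<subseteq> {..<N}" "C \<noteq> {}"
    and "let \<alpha> = real (card A) / real N; \<beta> = real (card B) / real N;
           \<gamma> = real (card C) / real N in
        \<alpha> * (ln (2 / (\<alpha> * \<beta> * \<gamma>))) powr (-14) \<ge> (1 / 10 ^ 15 * \<epsilon> * ln (real N)) powr (-2)"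
  then have hyp: "(c * \<epsilon> * ln (real N)) powr (-2) \<le> \<alpha> * L powr (-14)"
    by (simp only: Let_def \<alpha>_def \<beta>_def \<gamma>_def L_def c_def)
  have N1: "real N > 1" using N exp_gt_zero[of "exp (exp 1) :: real"] by linarith
  then have N0: "N > 0" by simp
  interpret cyclic "int N" using N0 by unfold_locales simp
  have fin: "finite A" "finite B" "finite C" using A B C finite_subset by blast+
  have cards: "0 < card A" "card A \<le> N" "0 < card B" "card B \<le> N" "0 < card C" "card C \<le> N"
    using fin A B C card_mono[of "{..<N}"] by (auto simp: card_gt_0_iff)
  have dens: "0 < \<alpha>" "\<alpha> \<le> 1" "0 < \<beta>" "\<beta> \<le> 1" "0 < \<gamma>" "\<gamma> \<le> 1"
    using cards by (auto simp: \<alpha>_def \<beta>_def \<gamma>_def)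
  have "\<alpha> * \<beta> \<le> 1" using dens by (intro mult_le_one) auto
  then have prod: "0 < \<alpha> * \<beta> * \<gamma>" "\<alpha> * \<beta> * \<gamma> \<le> 1" using dens by (auto intro: mult_le_one)
  have "ln 2 \<le> L" unfolding L_def using prod by (intro ln_mono) (auto simp: le_divide_eq)
  then have Lhalf: "1/2 \<le> L" using ln2_ge_two_thirds by linarith
  define E where "E = \<epsilon> * ln (real N)"
  have lnN: "ln (real N) > 0" using N1 by simp
  have E: "0 < E" "E \<le> ln (real N)" using \<epsilon> lnN by (auto simp: E_def)
  have c: "c > 0" by (simp add: c_def)
  define a where "a = sqrt \<alpha>"
  have a: "0 < a" "a \<le> 1" "a\<^sup>2 = \<alpha>" using dens by (auto simp: a_def)
  \<comment> \<open>The square root of the hypothesis; it says that X below is at least 1.\<close>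
  have big: "L ^ 7 \<le> c * a * E"
  proof -
    have "(c * E) powr (-2) = 1 / (c * E)\<^sup>2" using c E by (simp add: powr_minus_divide powr_numeral)
    moreover have "L powr (-14) = 1 / L ^ 14" using Lhalf by (simp add: powr_minus_divide powr_numeral)
    ultimately have "1 / (c * E)\<^sup>2 \<le> \<alpha> * (1 / L ^ 14)" using hyp by (simp add: E_def mult.assoc)
    then have "L ^ 14 \<le> \<alpha> * (c * E)\<^sup>2" using c E Lhalf by (simp add: field_simps)
    also have "\<dots> = (c * a * E)\<^sup>2" using a by (simp add: power_mult_distrib)
    finally have "(L ^ 7)\<^sup>2 \<le> (c * a * E)\<^sup>2" by (simp add: power_mult[symmetric])
    then show ?thesis by (rule power2_le_imp_le) (use c a E in simp)
  qed
  \<comment> \<open>This is the required exponent divided by sqrt c, so a length of exp X is more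
    than enough.\<close>
  define X where "X = sqrt (c * a * E / L ^ 7)"
  have X2: "X\<^sup>2 = c * a * E / L ^ 7" using c a E Lhalf by (simp add: X_def)
  have X1: "1 \<le> X" unfolding X_def using big Lhalf by (simp add: le_divide_eq)
  have XX: "X \<le> X\<^sup>2" using X1 by (simp add: power2_eq_square)
  have cancel: "L ^ (7 - i) * (X\<^sup>2 * L ^ i) = c * a * E" if "i \<le> 7" for i
  proof -
    have "L ^ (7 - i) * (X\<^sup>2 * L ^ i) = X\<^sup>2 * (L ^ (7 - i) * L ^ i)" by (rule mult.left_commute)
    also have "L ^ (7 - i) * L ^ i = L ^ 7" using that by (simp only: power_add[symmetric] le_add_diff_inverse2)
    also have "X\<^sup>2 * L ^ 7 = c * a * E" using Lhalf by (simp add: X2)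
    finally show ?thesis .
  qed
  \<comment> \<open>With X \<ge> 1 and L \<ge> 1/2 the factor 2 L makes m at least X, for the
    length, and at least L, as the progression lemma demands. There is room for it: L^3 m^2 is of
    order L^5 X^2 and L m of order L^2 X, against c a E = L^7 X^2.\<close>
  define m where "m = nat \<lceil>2 * L * X\<rceil>"
  have LX: "1/2 * 1 \<le> L * X" using Lhalf X1 by (intro mult_mono) auto
  have m_ge: "2 * L * X \<le> real m" unfolding m_def by (rule real_nat_ceiling_ge)
  have m_le: "real m \<le> 4 * (L * X)"
  proof -
    have "real m \<le> 2 * L * X + 1" unfolding m_def using LX by (intro real_nat_ceiling_le) simp
    then show ?thesis using LX by linarith
  qed
  have m1: "m \<ge> 1" using m_ge LX by linarith
  have "L * 1 \<le> L * X" using X1 Lhalf by (intro mult_left_mono) auto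
  then have Lm: "L \<le> real m" using m_ge Lhalf by linarith
  have Xm: "X \<le> real m"
  proof -
    have "1/2 * X \<le> L * X" using Lhalf X1 by (intro mult_right_mono) auto
    then show ?thesis using m_ge by linarith
  qed
  have size: "3 * 10 ^ 12 * L ^ 3 * (real m)\<^sup>2 \<le> sqrt \<alpha> * ln (real N)"
  proof -
    have "(1/2)\<^sup>2 \<le> L\<^sup>2" using Lhalf by (intro power_mono) auto
    then have L2: "1 \<le> 4 * L\<^sup>2" by (simp add: power2_eq_square)
    have "(real m)\<^sup>2 \<le> (4 * (L * X))\<^sup>2" using m_le by (intro power_mono) auto
    then have "3 * 10 ^ 12 * L ^ 3 * (real m)\<^sup>2 \<le> 3 * 10 ^ 12 * L ^ 3 * (4 * (L * X))\<^sup>2"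
      using Lhalf by (intro mult_left_mono) auto
    also have "\<dots> = 48 * 10 ^ 12 * (X\<^sup>2 * L ^ 5) * 1" by (simp add: power_mult_distrib eval_nat_numeral)
    also have "\<dots> \<le> 48 * 10 ^ 12 * (X\<^sup>2 * L ^ 5) * (4 * L\<^sup>2)"
      using L2 Lhalf by (intro mult_left_mono) auto
    also have "\<dots> = 192 * 10 ^ 12 * (L ^ 2 * (X\<^sup>2 * L ^ 5))" by simp
    also have "\<dots> = 192 * 10 ^ 12 * (c * a * E)" using cancel[of 5] by simp
    also have "\<dots> = 192 / 1000 * (a * E)" by (simp add: c_def)
    also have "\<dots> \<le> 1 * (a * E)" using a E by (intro mult_right_mono) auto
    also have "\<dots> \<le> a * ln (real N)" using a E by simp
    finally show ?thesis by (simp add: a_def)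
  qed
  \<comment> \<open>Equivalently exp (-20 L m) \<ge> N^(-\<epsilon>): the loss of representations
    stays within the allowed factor.\<close>
  have many: "20 * L * real m \<le> E"
  proof -
    have "(1/2) ^ 5 \<le> L ^ 5" using Lhalf by (intro power_mono) auto
    then have L5: "1 \<le> 32 * L ^ 5" by (simp add: eval_nat_numeral)
    have "20 * L * real m \<le> 20 * L * (4 * (L * X))" using m_le Lhalf by (intro mult_left_mono) auto
    also have "\<dots> = 80 * L\<^sup>2 * X" by (simp add: power2_eq_square)
    also have "\<dots> \<le> 80 * L\<^sup>2 * X\<^sup>2" using XX by (intro mult_left_mono) auto
    also have "\<dots> = 80 * (X\<^sup>2 * L\<^sup>2) * 1" by simp
    also have "\<dots> \<le> 80 * (X\<^sup>2 * L\<^sup>2) * (32 * L ^ 5)" using L5 by (intro mult_left_mono) auto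
    also have "\<dots> = 2560 * (L ^ 5 * (X\<^sup>2 * L\<^sup>2))" by simp
    also have "\<dots> = 2560 * (c * a * E)" using cancel[of 2] by simp
    also have "\<dots> = (2560 / 10 ^ 15 * a) * E" by (simp add: c_def)
    also have "\<dots> \<le> 1 * E" using a E by (intro mult_right_mono) auto
    finally show ?thesis by simp
  qed
  have long: "exp (c * \<alpha> powr (1/4) * E powr (1/2) * L powr (-7/2)) \<le> 4 ^ m"
  proof -
    let ?e = "c * \<alpha> powr (1/4) * E powr (1/2) * L powr (-7/2)"
    have sq: "(x powr r)\<^sup>2 = x powr (2 * r)" for x r :: real
      by (simp add: power2_eq_square powr_add[symmetric])
    have "?e\<^sup>2 = c\<^sup>2 * (\<alpha> powr (1/2)) * E powr 1 * L powr (-7)"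
      by (simp add: power_mult_distrib sq)
    also have "\<dots> = c * X\<^sup>2"
      unfolding X2 using dens E Lhalf by (simp add: a_def powr_half_sqrt powr_minus_divide powr_numeral power2_eq_square)
    also have "\<dots> \<le> 1 * X\<^sup>2" by (rule mult_right_mono) (simp_all add: c_def)
    finally have "?e\<^sup>2 \<le> X\<^sup>2" by (simp only: mult_1_left)
    then have "?e \<le> X" by (rule power2_le_imp_le) (use X1 in linarith)
    then have "exp ?e \<le> exp (real m)" using Xm by simp
    also have "\<dots> = exp 1 ^ m" by (simp add: exp_of_nat_mult[symmetric])
    also have "\<dots> \<le> 4 ^ m" using exp_le by (intro power_mono) auto
    finally show ?thesis .
  qed
  have sub: "int ` A \<subseteq> Z" "int ` B \<subseteq> Z" "int ` C \<subseteq> Z" using A B C by auto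
  have ne: "int ` A \<noteq> {}" "int ` B \<noteq> {}" "int ` C \<noteq> {}" using A B C by auto
  have ci: "card (int ` S) = card S" for S :: "nat set" by (simp add: card_image)
  obtain x q where q: "0 < q" "4 ^ m * q \<le> int N"
    and R: "\<And>j. j < 4 ^ m \<Longrightarrow> (real N)\<^sup>2 * exp (- 20 * L * real m)
       \<le> (\<Sum>c\<in>int ` C. real (card (int ` B)) * conv (int ` A) (int ` B) (x + int j * q - c))"
    using progression_with_many_representations[OF sub(1) ne(1) sub(2) ne(2) sub(3) ne(3) m1] Lm size
    unfolding ci of_int_of_nat_eq \<alpha>_def[symmetric] \<beta>_def[symmetric] \<gamma>_def[symmetric] L_def[symmetric]
    by blast
  \<comment> \<open>From 4^m q \<le> N and 4^m \<ge> 4 it follows that q < N, so the step is a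
    reduced residue. The same bound excludes wraparound, which makes the terms distinct.\<close>
  have four: "(4::int) ^ m \<ge> 4" using power_increasing[of 1 m "4::int"] m1 by simp
  have "4 * q \<le> 4 ^ m * q" using four q by (intro mult_right_mono) auto
  then have qN: "q < int N" using q by linarith
  define a0 where "a0 = nat (x mod int N)"
  define d where "d = nat q"
  have elem: "(a0 + i * d) mod N = nat ((x + int i * q) mod int N)" for i
  proof -
    have "int ((a0 + i * d) mod N) = (x mod int N + int i * q) mod int N"
      using N0 q by (simp add: a0_def d_def zmod_int)
    also have "\<dots> = (x + int i * q) mod int N" by (rule mod_add_left_eq)
    finally show ?thesis by (metis nat_int)
  qed
  have inj: "inj_on (\<lambda>i. (a0 + i * d) mod N) {..<4 ^ m}"
  proof (rule inj_onI)
    fix i j :: nat assume ij: "i \<in> {..<4 ^ m}" "j \<in> {..<4 ^ m}" "(a0 + i * d) mod N = (a0 + j * d) mod N"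
    have "int i < 4 ^ m" "int j < 4 ^ m" using ij by auto
    then have "\<bar>int i - int j\<bar> < 4 ^ m" by linarith
    then have "\<bar>int i - int j\<bar> * q < 4 ^ m * q" using q by (intro mult_strict_right_mono) auto
    then have "\<bar>int i - int j\<bar> * q < int N" using q(2) by linarith
    then have small: "\<bar>(int i - int j) * q\<bar> < int N" using q(1) by (simp add: abs_mult)
    have "(x + int i * q) mod int N = (x + int j * q) mod int N"
      using ij(3) N0 unfolding elem by (simp add: eq_nat_nat_iff)
    then have "int N dvd (int i - int j) * q" by (simp add: mod_eq_dvd_iff algebra_simps)
    then have "(int i - int j) * q = 0" using small by (metis dvd_imp_le_int abs_of_nat not_le)
    then show "i = j" using q by simp
  qed
  have ap: "ap_mod N a0 d (4 ^ m) = (\<lambda>i. (a0 + i * d) mod N) ` {..<4 ^ m}" by (auto simp: ap_mod_def)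
  have reps: "real N powr (2 - \<epsilon>) \<le> real (reps N A B C t)" if t: "t \<in> ap_mod N a0 d (4 ^ m)" for t
  proof -
    obtain i where i: "i < 4 ^ m" "t = nat ((x + int i * q) mod int N)" using t unfolding ap elem by auto
    have "real N powr (2 - \<epsilon>) = exp (2 * ln (real N) - E)" using N1 by (simp add: powr_def E_def algebra_simps)
    also have "\<dots> \<le> exp (2 * ln (real N) + (- 20 * L * real m))"
      unfolding exp_le_cancel_iff using many by linarith
    also have "\<dots> = (real N)\<^sup>2 * exp (- 20 * L * real m)"
      unfolding exp_add exp_double using N1 by simp
    also have "\<dots> \<le> real (reps N A B C t)"
      using R[OF i(1)] reps_eq_sum_conv[OF N0 A(1) B C(1)] by (simp add: i(2))
    finally show ?thesis .
  qed
  show "\<exists>a d L. a < N \<and> d < N \<and> card (ap_mod N a d L) = L \<and>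
         ap_mod N a d L \<subseteq> sumset3 N A B C \<and>
         (let \<alpha> = real (card A) / real N; \<beta> = real (card B) / real N;
              \<gamma> = real (card C) / real N in
           real L \<ge> exp (1 / 10 ^ 15 * \<alpha> powr (1/4) * (\<epsilon> * ln (real N)) powr (1/2)
                         * (ln (2 / (\<alpha> * \<beta> * \<gamma>))) powr (-7/2))) \<and>
         (\<forall>t \<in> ap_mod N a d L. real (reps N A B C t) \<ge> real N powr (2 - \<epsilon>))"
  proof (intro exI conjI ballI)
    show "a0 < N" using N0 by (simp add: a0_def nat_less_iff)
    show "d < N" using qN q by (simp add: d_def nat_less_iff)
    show "card (ap_mod N a0 d (4 ^ m)) = 4 ^ m" unfolding ap using card_image[OF inj] by simp
    show "ap_mod N a0 d (4 ^ m) \<subseteq> sumset3 N A B C"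
    proof
      fix t assume "t \<in> ap_mod N a0 d (4 ^ m)"
      then have "real N powr (2 - \<epsilon>) \<le> real (reps N A B C t)" by (rule reps)
      moreover have "0 < real N powr (2 - \<epsilon>)" using N1 by simp
      ultimately have "0 < reps N A B C t" by linarith
      then show "t \<in> sumset3 N A B C" by (rule sumset3_of_reps_pos)
    qed
    show "let \<alpha> = real (card A) / real N; \<beta> = real (card B) / real N; \<gamma> = real (card C) / real N in
           real (4 ^ m) \<ge> exp (1 / 10 ^ 15 * \<alpha> powr (1/4) * (\<epsilon> * ln (real N)) powr (1/2)
                         * (ln (2 / (\<alpha> * \<beta> * \<gamma>))) powr (-7/2))"
      using long by (simp only: Let_def \<alpha>_def \<beta>_def \<gamma>_def L_def c_def E_def) simp
  qed (rule reps)
qed simp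

end
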